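(* Let $f$ be the one-dimensional Lorenz map of a geometric Lorenz attractor. Then there is an increasing family $C_1\subset C_2\subset C_3\subset\cdots$ of regular Cantor sets for $f$ such that $HD(C_k)\to1$ as $k\to+\infty$.
   Context: $HD$ denotes Hausdorff dimension. One-dimensional Lorenz map. Let $I=[-1/2,1/2]$ and $0<\alpha<1$. The one-dimensional map $f:I\setminus\{0\}\to I$ of a geometric Lorenz attractor is $f(x)=f_0(|x|^\alpha)$ for $x>0$, $f(x)=f_1(|x|^\alpha)$ for $x<0$, with $f_i(u)=(-1)^i\theta u+b_i$ ($i=0,1$), satisfying: (i) $f(0^-)=1/2$ and $f(0^+)=-1/2$; (ii) $f'(x)>\sqrt2$ for all $x\in I\setminus\{0\}$; (iii) $f'(0^-)=f'(0^+)=+\infty$; and $f(-1/2)\neq-1/2$, $f(1/2)\ne1/2$. Regular Cantor set. A regular (dynamically defined) Cantor set is a Cantor set $K\subset\mathbb{R}$ together with (i) disjoint compact intervals $I_1,\dots,I_r$ such that $K\subset I_1\cup\cdots\cup I_r$ and the boundary of each $I_j$ is contained in $K$; (ii) a $C^{1+\epsilon}$ (for some $\epsilon>0$) expanding map $\psi$ defined in a neighborhood of $I_1\cup\dots\cup I_r$ such that for each $j$, $\psi(I_j)$ is the convex hull of a finite union of some of the intervals $I_s$; for each $j$ and all $n$ sufficiently large $\psi^n(K\cap I_j)=K$; and $K=\bigcap_{n\ge0}\psi^{-n}(I_1\cup\cdots\cup I_r)$. A regular Cantor set for $f$ is a regular Cantor set $K\subset I\setminus\{0\}$ whose defining map $\psi$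 coincides on each $I_j$ with an iterate $f^{n_j}$ of $f$, $n_j\geq 1$, where $0\notin f^s(I_j)$ for $0\le s<n_j$. *)

theory Defs
  imports "HOL-Analysis.Analysis"
begin

text \<open>
  In the Hausdorff measure, \<open>diameter\<close> has no meaningful value on unbounded sets, so the covering
  sets are required to be bounded.  The exponent \<open>s\<close> is only ever used with \<open>s > 0\<close>, so the
  value of \<open>0 powr 0\<close> is irrelevant.
\<close>

definition hausdorff_premeasure :: "real \<Rightarrow> real \<Rightarrow> 'a::metric_space set \<Rightarrow> ennreal" where
  "hausdorff_premeasure s \<delta> E =
     (INF A \<in> {A :: nat \<Rightarrow> 'a set. E \<subseteq> (\<Union>i. A i) \<and> (\<forall>i. bounded (A i) \<and> diameter (A i) \<le> \<delta>)}.
        \<Sum>i. ennreal (diameter (A i) powr s))"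

definition hausdorff_measure :: "real \<Rightarrow> 'a::metric_space set \<Rightarrow> ennreal" where
  "hausdorff_measure s E = (SUP \<delta>\<in>{0<..}. hausdorff_premeasure s \<delta> E)"

definition hausdorff_dim :: "'a::metric_space set \<Rightarrow> ereal" where
  "hausdorff_dim E = Inf {ereal s | s. 0 < s \<and> hausdorff_measure s E = 0}"

abbreviation lorenz_interval :: "real set" where
  "lorenz_interval \<equiv> {-1/2..1/2}"

text \<open>
  A Lorenz map is defined on \<open>lorenz_interval - {0}\<close> only; the values of \<open>f\<close> elsewhere are
  unconstrained.  Derivatives are relative to the domain, hence one-sided at \<open>-1/2\<close> and \<open>1/2\<close>.
\<close>

definition lorenz_map :: "real \<Rightarrow> (real \<Rightarrow> real) \<Rightarrow> bool" where
  "lorenz_map \<alpha> f \<longleftrightarrow>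
     (\<exists>\<theta> b\<^sub>0 b\<^sub>1.
        (\<forall>x\<in>lorenz_interval. x > 0 \<longrightarrow> f x = \<theta> * (\<bar>x\<bar> powr \<alpha>) + b\<^sub>0) \<and>
        (\<forall>x\<in>lorenz_interval. x < 0 \<longrightarrow> f x = - \<theta> * (\<bar>x\<bar> powr \<alpha>) + b\<^sub>1)) \<and>
     f ` (lorenz_interval - {0}) \<subseteq> lorenz_interval \<and>
     (f \<longlongrightarrow> 1/2) (at_left 0) \<and> (f \<longlongrightarrow> - 1/2) (at_right 0) \<and>
     (\<exists>f'. (\<forall>x\<in>lorenz_interval - {0}.
              (f has_real_derivative f' x) (at x within lorenz_interval - {0}) \<and> f' x > sqrt 2) \<and>
           filterlim f' at_top (at_left 0) \<and> filterlim f' at_top (at_right 0)) \<and>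
     f (- 1/2) \<noteq> - 1/2 \<and> f (1/2) \<noteq> 1/2"

definition cantor_set :: "'a::metric_space set \<Rightarrow> bool" where
  "cantor_set K \<longleftrightarrow>
     K \<noteq> {} \<and> compact K \<and> (\<forall>x\<in>K. x islimpt K) \<and> (\<forall>x\<in>K. connected_component_set K x = {x})"

text \<open>
  \<open>C\<^sup>1\<^sup>+\<^sup>\<epsilon>\<close> with uniform constants on \<open>U\<close>.  Below, \<open>U\<close> is some neighbourhood of a compact set and
  may be shrunk, so this agrees with asking for the bounds only locally.
\<close>

definition C1_Hoelder_on :: "real \<Rightarrow> real set \<Rightarrow> (real \<Rightarrow> real) \<Rightarrow> bool" where
  "C1_Hoelder_on \<epsilon> U \<psi> \<longleftrightarrow>
     (\<forall>x\<in>U. \<psi> differentiable (at x)) \<and>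
     (\<exists>C. \<forall>x\<in>U. \<forall>y\<in>U. \<bar>deriv \<psi> x - deriv \<psi> y\<bar> \<le> C * \<bar>x - y\<bar> powr \<epsilon>)"

definition expanding_on :: "real set \<Rightarrow> (real \<Rightarrow> real) \<Rightarrow> bool" where
  "expanding_on U \<psi> \<longleftrightarrow> (\<exists>c>1. \<forall>x\<in>U. \<bar>deriv \<psi> x\<bar> \<ge> c)"

text \<open>
  The intervals are \<open>{a j..b j}\<close> for \<open>j < r\<close>.  The map \<open>\<psi>\<close> is total, but only its values on
  the neighbourhood \<open>U\<close> of the intervals matter: an orbit that leaves the intervals is discarded
  by the last condition at the time it leaves.
\<close>

definition regular_cantor_set ::
    "real set \<Rightarrow> nat \<Rightarrow> (nat \<Rightarrow> real) \<Rightarrow> (nat \<Rightarrow> real) \<Rightarrow> (real \<Rightarrow> real) \<Rightarrow> bool" where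
  "regular_cantor_set K r a b \<psi> \<longleftrightarrow>
     cantor_set K \<and>
     (\<forall>j<r. a j < b j) \<and>
     disjoint_family_on (\<lambda>j. {a j..b j}) {..<r} \<and>
     K \<subseteq> (\<Union>j<r. {a j..b j}) \<and>
     (\<forall>j<r. frontier {a j..b j} \<subseteq> K) \<and>
     (\<exists>U \<epsilon>. open U \<and> (\<Union>j<r. {a j..b j}) \<subseteq> U \<and> 0 < \<epsilon> \<and> \<epsilon> \<le> 1 \<and>
            C1_Hoelder_on \<epsilon> U \<psi> \<and> expanding_on U \<psi>) \<and>
     (\<forall>j<r. \<exists>S\<subseteq>{..<r}. \<psi> ` {a j..b j} = convex hull (\<Union>s\<in>S. {a s..b s})) \<and>
     (\<forall>j<r. \<forall>\<^sub>F n in sequentially. (\<psi> ^^ n) ` (K \<inter> {a j..b j}) = K) \<and>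
     K = (\<Inter>n. (\<psi> ^^ n) -` (\<Union>j<r. {a j..b j}))"

definition regular_cantor_set_for :: "(real \<Rightarrow> real) \<Rightarrow> real set \<Rightarrow> bool" where
  "regular_cantor_set_for f K \<longleftrightarrow>
     K \<subseteq> lorenz_interval - {0} \<and>
     (\<exists>r a b \<psi>. regular_cantor_set K r a b \<psi> \<and>
        (\<forall>j<r. \<exists>n\<ge>1.
           (\<forall>x\<in>{a j..b j}. \<psi> x = (f ^^ n) x) \<and>
           (\<forall>s<n. 0 \<notin> (f ^^ s) ` {a j..b j})))"

end

theory Submission
  imports Defs
begin

text \<open>
  The map is odd and \<open>f x = \<theta> x\<^sup>\<alpha> - 1/2\<close> for \<open>x > 0\<close>.  Fix an interval \<open>A\<close> and consider the inverse
  branches \<open>g\<close> of \<open>f\<^sup>n\<close> that map \<open>A\<close> into \<open>A\<close>.  Their limit sets are regular Cantor sets, and the one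
  for \<open>n\<close> is contained in the one for \<open>n m\<close>, so it suffices to find, for each \<open>s < 1\<close>, one \<open>n\<close> for which the
  dimension is at least \<open>s\<close>.  This holds as soon as the sum of \<open>(inf g')\<^sup>s\<close> over all such \<open>g\<close> is at least \<open>1\<close>;
  as \<open>g'\<close> decays exponentially in \<open>n\<close>, it is enough that the sum of \<open>inf g'\<close> is bounded below along
  arbitrarily large \<open>n\<close>.

  Since \<open>1/f'\<close> is continuous and vanishes at the discontinuity, a Lasota--Yorke inequality bounds the
  total variation of all inverse branch derivatives uniformly in \<open>n\<close>, while their total integral is
  constant.  On a sufficiently fine partition the oscillation is then negligible, so for every \<open>n\<close> one of finitely
  many cells is the domain of full branches into \<open>A\<close> whose \<open>inf g'\<close> have a definite sum.  Because the slope
  exceeds \<open>\<surd>2\<close>, every cell contains the image of \<open>A\<close> under some inverse branch, which closes the loop.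
\<close>

subsection \<open>Hausdorff dimension\<close>

text \<open>The branches of \<open>f ^^ n\<close> have no Markov structure: the cuts produced by the
  orbit of 0 need not fit any partition. Moreover the logarithm of f' is unbounded near 0, so a
  bounded-distortion argument is not at hand. Both difficulties are moved into one function per
  word: the density \<open>den w\<close> is the derivative of the inverse branch, set to 0 wherever
  the branch leaves A = [1/8,1/4]. A cut then shows up as variation, and a positive lower bound of
  \<open>den w\<close> on a whole cell certifies that the branch maps that cell into A. This is why
  variations are summed word by word; the variation of the summed density would not tell full
  branches from cut ones.

  The interval A is closed, which makes the limit sets compact, and it lies away from 0 and from the
  endpoints -1/2, 1/2. Orbits counted by a full word stay in the open interval and avoid 0 until
  they return to A, so distinct words of equal length have disjoint closed images, around which
  \<open>f ^^ n\<close> is smooth.\<close>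

lemma hausdorff_measure_mono:
  assumes "E \<subseteq> F"
  shows "hausdorff_measure s E \<le> hausdorff_measure s F"
proof -
  have "hausdorff_premeasure s \<delta> E \<le> hausdorff_premeasure s \<delta> F" for \<delta>
    unfolding hausdorff_premeasure_def using assms by (intro INF_superset_mono) auto
  then show ?thesis
    unfolding hausdorff_measure_def by (intro SUP_mono) auto
qed

lemma hausdorff_dim_mono:
  assumes "E \<subseteq> F"
  shows "hausdorff_dim E \<le> hausdorff_dim F"
  unfolding hausdorff_dim_def
proof (rule Inf_superset_mono, safe)
  fix s :: real assume s: "0 < s" "hausdorff_measure s F = 0"
  have "hausdorff_measure s E = 0"
    using hausdorff_measure_mono[OF assms, of s] s by simp
  then show "\<exists>s'. ereal s = ereal s' \<and> 0 < s' \<and> hausdorff_measure s' E = 0"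
    using s by blast
qed

text \<open>A grid of N + 1 intervals of length 2R/(N + 1) costs a constant times (N + 1) powr (1 -
  s), which tends to 0.\<close>

lemma hausdorff_measure_eq_0:
  fixes E :: "real set"
  assumes "bounded E" "1 < s"
  shows "hausdorff_measure s E = 0"
proof -
  obtain R where R: "R > 0" "E \<subseteq> {-R..R}"
  proof -
    obtain R where "R > 0" "\<And>x. x \<in> E \<Longrightarrow> \<bar>x\<bar> \<le> R"
      using assms(1) by (metis bounded_pos real_norm_def)
    then show ?thesis by (intro that[of R]) (auto simp: abs_le_iff minus_le_iff)
  qed
  have "hausdorff_premeasure s \<delta> E = 0" if \<delta>: "\<delta> > 0" for \<delta>
  proof -
    define B where "B N = real (Suc N) * (2 * R / real (Suc N)) powr s" for N
    have cover: "hausdorff_premeasure s \<delta> E \<le> ennreal (B N)" if N: "2 * R / real (Suc N) \<le> \<delta>" for N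
    proof -
      define h where "h = 2 * R / real (Suc N)"
      have h: "h > 0" using R by (simp add: h_def)
      define A where "A i = (if i \<le> N then {-R + real i * h..-R + real (Suc i) * h} else {})" for i
      have "E \<subseteq> (\<Union>i. A i)"
      proof
        fix x assume "x \<in> E"
        then have x: "-R \<le> x" "x \<le> R" using R by auto
        have hN: "real (Suc N) * h = 2 * R" by (simp add: h_def)
        show "x \<in> (\<Union>i. A i)"
        \<comment> \<open>At the right endpoint the floor index used below would be N + 1, one past
          the last interval.\<close>
        proof (cases "x = R")
          case True
          have "x \<in> A N" using hN h True by (simp add: A_def algebra_simps)
          then show ?thesis by blast
        next
          case False
          define i where "i = nat \<lfloor>(x + R) / h\<rfloor>"
          have nn: "0 \<le> (x + R) / h" using x h by simp
          have i: "real i \<le> (x + R) / h" "(x + R) / h < real i + 1"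
            using nn by (simp_all add: i_def)
          have "(x + R) / h < real (Suc N)"
            using x False h hN by (simp add: divide_simps mult.commute)
          then have "i \<le> N" using i by linarith
          moreover have "-R + real i * h \<le> x" "x \<le> -R + real (Suc i) * h"
            using i h by (auto simp: field_simps)
          ultimately have "x \<in> A i" by (simp add: A_def)
          then show ?thesis by blast
        qed
      qed
      moreover have dA: "diameter (A i) = (if i \<le> N then h else 0)" for i
        using h by (auto simp: A_def diameter_closed_interval algebra_simps)
      moreover have "bounded (A i)" for i by (simp add: A_def)
      moreover have "h \<le> \<delta>" using N by (simp add: h_def)
      ultimately have "hausdorff_premeasure s \<delta> E \<le> (\<Sum>i. ennreal (diameter (A i) powr s))"
        unfolding hausdorff_premeasure_def using \<delta> by (intro INF_lower) auto
      also have "\<dots> = (\<Sum>i\<in>{..N}. ennreal (diameter (A i) powr s))"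
        by (rule suminf_finite) (auto simp: dA)
      also have "\<dots> = (\<Sum>i\<in>{..N}. ennreal (h powr s))"
        by (rule sum.cong) (auto simp: dA)
      also have "\<dots> = ennreal (B N)"
        by (simp add: B_def h_def ennreal_mult' ennreal_of_nat_eq_real_of_nat)
      finally show ?thesis .
    qed
    have lim: "(\<lambda>N. (2 * R) powr s * real (Suc N) powr (1 - s)) \<longlonglongrightarrow> (2 * R) powr s * 0"
      by (intro tendsto_intros tendsto_neg_powr filterlim_compose[OF filterlim_real_sequentially filterlim_Suc])
        (use assms in auto)
    have "B N = (2 * R) powr s * real (Suc N) powr (1 - s)" for N
      using R by (simp add: B_def powr_divide powr_diff)
    then have "B = (\<lambda>N. (2 * R) powr s * real (Suc N) powr (1 - s))" by blast
    then have "B \<longlonglongrightarrow> 0" using lim by simp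
    then have "(\<lambda>N. ennreal (B N)) \<longlonglongrightarrow> 0" using tendsto_ennrealI by fastforce
    moreover have "\<forall>\<^sub>F N in sequentially. 2 * R / real (Suc N) \<le> \<delta>"
    proof -
      have "(\<lambda>N. 2 * R / real (Suc N)) \<longlonglongrightarrow> 0"
        using lim_const_over_n[of "2 * R"] LIMSEQ_Suc by blast
      then have "\<forall>\<^sub>F N in sequentially. 2 * R / real (Suc N) < \<delta>"
        using \<delta> by (simp add: order_tendsto_iff)
      then show ?thesis by (rule eventually_mono) simp
    qed
    ultimately have "hausdorff_premeasure s \<delta> E \<le> 0"
      using cover by (intro tendsto_lowerbound[of "\<lambda>N. ennreal (B N)"]) (auto elim: eventually_mono)
    then show ?thesis by simp
  qed
  then show ?thesis by (simp add: hausdorff_measure_def)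
qed

lemma hausdorff_dim_le_1:
  fixes E :: "real set"
  assumes "bounded E"
  shows "hausdorff_dim E \<le> 1"
proof (rule ereal_le_epsilon2)
    fix e :: real assume e: "0 < e"
    have "hausdorff_dim E \<le> ereal (1 + e)"
      unfolding hausdorff_dim_def using hausdorff_measure_eq_0[OF assms, of "1 + e"] e
      by (intro Inf_lower) auto
    then show "hausdorff_dim E \<le> 1 + ereal e" by (simp add: one_ereal_def)
qed

section \<open>Lower bounds for the Hausdorff measure of a compact set\<close>

lemma thicken_powr:
  fixes S :: "'a::real_normed_vector set"
  assumes "bounded S" "0 < t" "0 < \<epsilon>"
  obtains G where "open G" "S \<subseteq> G" "bounded G" "diameter G powr t \<le> diameter S powr t + \<epsilon>"
proof -
  have d0: "0 \<le> diameter S" using assms diameter_ge_0 by blast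
  \<comment> \<open>When S has diameter 0 the base tends to 0; this is where t > 0 enters.\<close>
  have "((\<lambda>e. (diameter S + 2 * e) powr t) \<longlongrightarrow> (diameter S + 2 * 0) powr t) (at_right 0)"
    using assms d0
    by (intro tendsto_powr' tendsto_intros) (auto simp: eventually_at_filter)
  then have "\<forall>\<^sub>F e in at_right 0. (diameter S + 2 * e) powr t < diameter S powr t + \<epsilon>"
    using assms(3) by (simp add: order_tendsto_iff)
  then have "\<forall>\<^sub>F e in at_right 0. (diameter S + 2 * e) powr t < diameter S powr t + \<epsilon> \<and> (0::real) < e"
    by (intro eventually_conj) (auto simp: eventually_at_right_less)
  then obtain e :: real where e: "e > 0" "(diameter S + 2 * e) powr t < diameter S powr t + \<epsilon>"
    using eventually_happens' trivial_limit_at_right_real by (metis (no_types, lifting))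
  define G where "G = (\<Union>a\<in>S. ball a e)"
  have dG: "dist x y \<le> diameter S + 2 * e" if xy: "x \<in> G" "y \<in> G" for x y
  proof -
    obtain a b where ab: "a \<in> S" "b \<in> S" "dist a x < e" "dist b y < e"
      using xy by (auto simp: G_def)
    have "dist x y \<le> dist a x + dist a b + dist b y"
      by metric
    also have "\<dots> \<le> diameter S + 2 * e"
      using ab diameter_bounded_bound[OF assms(1) ab(1,2)] by linarith
    finally show ?thesis .
  qed
  have "bounded G"
    by (rule bounded_two_points[THEN iffD2]) (use dG in blast)
  moreover have "diameter G \<le> diameter S + 2 * e"
    by (rule diameter_le) (use dG d0 e in \<open>auto simp: dist_norm\<close>)
  then have "diameter G powr t \<le> (diameter S + 2 * e) powr t"
    using assms \<open>bounded G\<close> by (intro powr_mono2) (auto simp: diameter_ge_0)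
  ultimately show ?thesis using e
    by (intro that[of G]) (auto simp: G_def)
qed

text \<open>Thickening turns a countable cover into an open one at total cost c/2, and compactness
  extracts a finite subcover. So a bound for finite covers by bounded sets of any size
  suffices.\<close>

lemma hausdorff_measure_compact_pos:
  fixes K :: "'a::real_normed_vector set"
  assumes K: "compact K" and t: "0 < t" and c: "0 < c"
    and fin: "\<And>(F :: nat set) G. finite F \<Longrightarrow> (\<And>i. i \<in> F \<Longrightarrow> bounded (G i)) \<Longrightarrow> K \<subseteq> (\<Union>i\<in>F. G i) \<Longrightarrow>
               c \<le> (\<Sum>i\<in>F. diameter (G i) powr t)"
  shows "hausdorff_measure t K \<noteq> 0"
proof -
  have "ennreal (c / 2) \<le> (\<Sum>i. ennreal (diameter (A i) powr t))"
    if A: "K \<subseteq> (\<Union>i. A i)" "\<And>i. bounded (A i)" for A :: "nat \<Rightarrow> 'a set"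
  proof -
    define \<epsilon> where "\<epsilon> i = (c / 2) * (1 / 2) ^ Suc i" for i :: nat
    have \<epsilon>: "\<epsilon> i > 0" for i using c by (simp add: \<epsilon>_def)
    have "\<forall>i. \<exists>G. open G \<and> A i \<subseteq> G \<and> bounded G \<and> diameter G powr t \<le> diameter (A i) powr t + \<epsilon> i"
      using thicken_powr[OF A(2) t \<epsilon>] by metis
    then obtain G where G: "\<And>i. open (G i)" "\<And>i. A i \<subseteq> G i" "\<And>i. bounded (G i)"
      "\<And>i. diameter (G i) powr t \<le> diameter (A i) powr t + \<epsilon> i"
      by metis
    obtain F where F: "finite F" "K \<subseteq> (\<Union>i\<in>F. G i)"
      using compactE_image[OF K, of UNIV G] G A(1) by (metis (no_types, lifting) UN_mono order_trans subset_UNIV)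
    have "c \<le> (\<Sum>i\<in>F. diameter (G i) powr t)" using fin[OF F(1)] G(3) F(2) by blast
    also have "\<dots> \<le> (\<Sum>i\<in>F. diameter (A i) powr t) + (\<Sum>i\<in>F. \<epsilon> i)"
      using G(4) by (simp add: sum.distrib[symmetric] sum_mono)
    also have "(\<Sum>i\<in>F. \<epsilon> i) \<le> c / 2"
    proof -
      have "\<epsilon> sums (c / 2 * 1)" unfolding \<epsilon>_def by (intro sums_mult power_half_series)
      then show ?thesis using sum_le_suminf[of \<epsilon> F] \<epsilon> F(1)
        by (metis less_imp_le mult.right_neutral sums_iff sums_summable)
    qed
    finally have "c / 2 \<le> (\<Sum>i\<in>F. diameter (A i) powr t)" by simp
    then have "ennreal (c / 2) \<le> ennreal (\<Sum>i\<in>F. diameter (A i) powr t)" by (rule ennreal_leI)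
    also have "\<dots> = (\<Sum>i\<in>F. ennreal (diameter (A i) powr t))" by simp
    also have "\<dots> \<le> (\<Sum>i. ennreal (diameter (A i) powr t))"
      by (intro sum_le_suminf F) auto
    finally show ?thesis .
  qed
  then have "ennreal (c / 2) \<le> hausdorff_premeasure t 1 K"
    unfolding hausdorff_premeasure_def by (intro INF_greatest) auto
  also have "\<dots> \<le> hausdorff_measure t K"
    unfolding hausdorff_measure_def by (intro SUP_upper) auto
  finally show ?thesis using c by (auto simp: ennreal_eq_0_iff)
qed

subsection \<open>Iterated function systems on an interval\<close>

lemma frontier_Icc_subset: "frontier {u..v} \<subseteq> {u, v}" for u v :: real
  by (auto simp: frontier_def)

text \<open>\<open>disj\<close> concerns images of a closed interval, so the pieces are separated by
  gaps of positive width. The map \<psi> is only asked to invert the branches; elsewhere it is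
  arbitrary and may be discontinuous.\<close>

locale separated_ifs =
  fixes p q \<rho> :: real and r :: nat and g :: "nat \<Rightarrow> real \<Rightarrow> real" and \<psi> :: "real \<Rightarrow> real"
  assumes pq: "p < q" and \<rho>: "0 \<le> \<rho>" "\<rho> < 1"
    and maps: "j < r \<Longrightarrow> x \<in> {p..q} \<Longrightarrow> g j x \<in> {p..q}"
    and incr: "j < r \<Longrightarrow> x \<in> {p..q} \<Longrightarrow> y \<in> {p..q} \<Longrightarrow> x < y \<Longrightarrow> g j x < g j y"
    and contr: "j < r \<Longrightarrow> x \<in> {p..q} \<Longrightarrow> y \<in> {p..q} \<Longrightarrow> x < y \<Longrightarrow> g j y - g j x \<le> \<rho> * (y - x)"
    and disj: "i < r \<Longrightarrow> j < r \<Longrightarrow> x \<in> {p..q} \<Longrightarrow> y \<in> {p..q} \<Longrightarrow> g i x = g j y \<Longrightarrow> i = j"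
    and inverse: "j < r \<Longrightarrow> x \<in> {p..q} \<Longrightarrow> \<psi> (g j x) = x"
begin

definition images :: "real set" where
  "images = (\<Union>j<r. g j ` {p..q})"

definition limit_set :: "real set" where
  "limit_set = {x. \<forall>k. (\<psi> ^^ k) x \<in> images}"

lemma limit_set_subset: "limit_set \<subseteq> images" "limit_set \<subseteq> {p..q}"
proof -
  show *: "limit_set \<subseteq> images"
  proof
    fix x assume "x \<in> limit_set"
    then have "(\<psi> ^^ 0) x \<in> images" unfolding limit_set_def by blast
    then show "x \<in> images" by simp
  qed
  show "limit_set \<subseteq> {p..q}" using * maps by (fastforce simp: images_def)
qed

lemma psi_limit_set: "x \<in> limit_set \<Longrightarrow> \<psi> x \<in> limit_set"
  unfolding limit_set_def mem_Collect_eq by (metis funpow_Suc_right comp_apply)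

lemma branch_limit_set:
  assumes "j < r" "y \<in> limit_set"
  shows "g j y \<in> limit_set"
proof -
  have y: "y \<in> {p..q}" using assms limit_set_subset by blast
  have "(\<psi> ^^ k) (g j y) \<in> images" for k
  proof (cases k)
    case 0
    then show ?thesis using assms(1) y unfolding images_def by (metis UN_I funpow_0 imageI lessThan_iff)
  next
    case (Suc m)
    have "(\<psi> ^^ Suc m) (g j y) = (\<psi> ^^ m) y"
      using inverse[OF assms(1) y] by (simp add: funpow_swap1)
    then show ?thesis using assms(2) Suc by (simp add: limit_set_def)
  qed
  then show ?thesis by (simp add: limit_set_def)
qed

lemma limit_set_cases:
  assumes "x \<in> limit_set"
  obtains j y where "j < r" "y \<in> limit_set" "x = g j y" "\<psi> x = y"
proof -
  obtain j y where jy: "j < r" "y \<in> {p..q}" "x = g j y"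
    using assms limit_set_subset by (auto simp: images_def)
  then have "\<psi> x = y" using inverse by simp
  then show ?thesis using that jy psi_limit_set[OF assms] by blast
qed

lemma branch_abs_contr:
  assumes "j < r" "x \<in> {p..q}" "y \<in> {p..q}"
  shows "\<bar>g j x - g j y\<bar> \<le> \<rho> * \<bar>x - y\<bar>"
  using assms contr[of j x y] contr[of j y x] incr[of j x y] incr[of j y x]
  by (cases x y rule: linorder_cases) auto

lemma branch_inj:
  assumes "j < r" "x \<in> {p..q}" "y \<in> {p..q}" "g j x = g j y"
  shows "x = y"
  using assms inverse by metis

lemma branch_mono:
  assumes "j < r" "x \<in> {p..q}" "y \<in> {p..q}" "x \<le> y"
  shows "g j x \<le> g j y"
  using assms incr[of j x y] by (cases "x = y") auto

lemma branch_less_iff: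
  assumes "j < r" "x \<in> {p..q}" "y \<in> {p..q}"
  shows "g j x \<le> g j y \<longleftrightarrow> x \<le> y"
  using assms incr[of j x y] incr[of j y x] by (cases x y rule: linorder_cases) auto

lemma branch_continuous: "j < r \<Longrightarrow> continuous_on {p..q} (g j)"
  by (rule lipschitz_on_continuous_on[of \<rho>], rule lipschitz_onI)
    (use branch_abs_contr \<rho> in \<open>auto simp: dist_real_def\<close>)

lemma branch_image:
  assumes "j < r" "p \<le> u" "u \<le> v" "v \<le> q"
  shows "g j ` {u..v} = {g j u..g j v}"
proof
  show "g j ` {u..v} \<subseteq> {g j u..g j v}"
    using assms branch_mono[OF assms(1)] by auto
  show "{g j u..g j v} \<subseteq> g j ` {u..v}"
  proof
    fix z assume z: "z \<in> {g j u..g j v}"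
    have "continuous_on {u..v} (g j)"
      by (rule continuous_on_subset[OF branch_continuous]) (use assms in auto)
    then obtain x where "u \<le> x" "x \<le> v" "g j x = z"
      using IVT'[of "g j" u z v] z assms by auto
    then show "z \<in> g j ` {u..v}" by auto
  qed
qed

lemma closed_branch_image: "j < r \<Longrightarrow> closed (g j ` {p..q})"
  using branch_image[of j p q] pq by simp

lemma images_gap:
  obtains d where "0 < d"
    "\<And>i j x y. i < r \<Longrightarrow> j < r \<Longrightarrow> i \<noteq> j \<Longrightarrow> x \<in> g i ` {p..q} \<Longrightarrow> y \<in> g j ` {p..q} \<Longrightarrow> d \<le> \<bar>x - y\<bar>"
proof -
  have "\<exists>d>0. \<forall>x\<in>g i ` {p..q}. \<forall>y\<in>g j ` {p..q}. d \<le> dist x y" if ij: "i < r" "j < r" "i \<noteq> j" for i j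
  proof (rule separate_compact_closed)
    show "compact (g i ` {p..q})" using branch_image[of i p q] ij pq by simp
    show "closed (g j ` {p..q})" using closed_branch_image ij by simp
    show "g i ` {p..q} \<inter> g j ` {p..q} = {}" using disj ij by blast
  qed
  then obtain d where d: "\<And>i j. i < r \<Longrightarrow> j < r \<Longrightarrow> i \<noteq> j \<Longrightarrow>
      0 < d i j \<and> (\<forall>x\<in>g i ` {p..q}. \<forall>y\<in>g j ` {p..q}. d i j \<le> \<bar>x - y\<bar>)"
    unfolding dist_real_def by metis
  define P where "P = {(i, j). i < r \<and> j < r \<and> i \<noteq> j}"
  have fin: "finite P"
    by (rule finite_subset[of _ "{..<r} \<times> {..<r}"]) (auto simp: P_def)
  define e where "e = Min (insert 1 ((\<lambda>(i, j). d i j) ` P))"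
  show ?thesis
  proof (rule that[of e])
    show "0 < e" unfolding e_def using fin d by (auto simp: P_def)
    fix i j x y assume *: "i < r" "j < r" "i \<noteq> j" "x \<in> g i ` {p..q}" "y \<in> g j ` {p..q}"
    have "e \<le> d i j" unfolding e_def using fin * by (intro Min_le) (force simp: P_def)+
    also have "\<dots> \<le> \<bar>x - y\<bar>" using d[OF *(1-3)] *(4,5) by blast
    finally show "e \<le> \<bar>x - y\<bar>" .
  qed
qed

text \<open>As \<psi> need not be continuous, closedness is not read off from the definition. The
  set is rewritten as the intersection of the m-fold images \<open>L m\<close> of {p..q}, which are
  compact because the branches are continuous.\<close>

lemma compact_limit_set: "compact limit_set"
proof -
  define L where "L m = ((\<lambda>S. \<Union>j<r. g j ` S) ^^ m) {p..q}" for m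
  have L0: "L 0 = {p..q}" and LS: "L (Suc m) = (\<Union>j<r. g j ` L m)" for m
    by (simp_all add: L_def)
  have sub: "L m \<subseteq> {p..q}" for m
    by (induction m) (use maps in \<open>auto simp: L0 LS\<close>)
  have comp: "compact (L m)" for m
  proof (induction m)
    case (Suc m)
    have "compact (g j ` L m)" if "j < r" for j
      using Suc sub branch_continuous[OF that] continuous_on_subset by (intro compact_continuous_image) blast+
    then show ?case by (auto simp: LS intro: compact_UN)
  qed (simp add: L0)
  have "x \<in> L m" if "x \<in> limit_set" for x m
    using that
  proof (induction m arbitrary: x)
    case 0
    then show ?case using limit_set_subset by (auto simp: L0)
  next
    case (Suc m)
    then obtain j y where "j < r" "y \<in> limit_set" "x = g j y" by (metis limit_set_cases)
    then show ?case using Suc.IH by (auto simp: LS)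
  qed
  moreover have "(\<psi> ^^ k) x \<in> images" if "x \<in> L (Suc k)" for x k
    using that
  proof (induction k arbitrary: x)
    case 0
    then show ?case by (simp add: LS L0 images_def)
  next
    case (Suc k)
    then obtain j y where jy: "j < r" "y \<in> L (Suc k)" "x = g j y" using LS[of "Suc k"] by blast
    have "(\<psi> ^^ Suc k) x = (\<psi> ^^ k) y"
      using inverse[of j y] jy sub[of "Suc k"] by (auto simp: funpow_swap1)
    then show ?case using Suc.IH jy by simp
  qed
  ultimately have "limit_set = (\<Inter>m. L m)"
    unfolding limit_set_def by blast
  then show ?thesis using comp by (auto intro!: compact_Inter)
qed

text \<open>The witness is a fixed point of \<open>g j\<close>, whose orbit under \<psi> is
  constant.\<close>

lemma branch_meets_limit_set:
  assumes "j < r"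
  obtains x where "x \<in> limit_set" "x \<in> g j ` {p..q}"
proof -
  have "continuous_on {p..q} (\<lambda>x. x - g j x)"
    by (intro continuous_intros branch_continuous assms)
  moreover have "p - g j p \<le> 0" "0 \<le> q - g j q"
    using maps[OF assms, of p] maps[OF assms, of q] pq by auto
  ultimately obtain x where x: "p \<le> x" "x \<le> q" "x - g j x = 0"
    using IVT'[of "\<lambda>x. x - g j x" p 0 q] pq by auto
  have fixp: "\<psi> x = x" using inverse[OF assms, of x] x by simp
  have "(\<psi> ^^ k) x = x" for k by (induction k) (auto simp: fixp)
  moreover have "x \<in> g j ` {p..q}" using x by (metis atLeastAtMost_iff eq_iff_diff_eq_0 imageI)
  ultimately show ?thesis
    using assms by (intro that[of x]) (auto simp: limit_set_def images_def)
qed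

text \<open>No point is isolated: x is a branch image of \<open>\<psi> x\<close>, and a second point
  near \<open>\<psi> x\<close> is carried back by the same branch with its distance reduced by
  \<rho>. Two distinct points are needed to start.\<close>

lemma limit_set_nearby:
  assumes "u \<in> limit_set" "v \<in> limit_set" "u \<noteq> v" "x \<in> limit_set"
  shows "\<exists>z\<in>limit_set. z \<noteq> x \<and> \<bar>z - x\<bar> \<le> \<rho> ^ m * (q - p)"
  using assms(4)
proof (induction m arbitrary: x)
  case 0
  obtain z where "z \<in> limit_set" "z \<noteq> x" using assms by metis
  moreover have "z \<in> {p..q}" "x \<in> {p..q}" using calculation 0 limit_set_subset(2) by blast+
  then have "\<bar>z - x\<bar> \<le> q - p" by auto
  ultimately show ?case by auto
next
  case (Suc m)
  obtain j y where jy: "j < r" "y \<in> limit_set" "x = g j y" using limit_set_cases[OF Suc.prems] by metis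
  obtain z where z: "z \<in> limit_set" "z \<noteq> y" "\<bar>z - y\<bar> \<le> \<rho> ^ m * (q - p)" using Suc.IH[OF jy(2)] by blast
  have in_pq: "z \<in> {p..q}" "y \<in> {p..q}" using z jy limit_set_subset by blast+
  have "\<bar>g j z - x\<bar> \<le> \<rho> * \<bar>z - y\<bar>" using branch_abs_contr[OF jy(1) in_pq] jy by simp
  also have "\<dots> \<le> \<rho> * (\<rho> ^ m * (q - p))" by (rule mult_left_mono) (use z \<rho> in auto)
  finally have "\<bar>g j z - x\<bar> \<le> \<rho> ^ Suc m * (q - p)" by (simp add: mult.assoc)
  moreover have "g j z \<noteq> x" using branch_inj[OF jy(1) in_pq] jy z by blast
  ultimately show ?case using branch_limit_set[OF jy(1) z(1)] by blast
qed

text \<open>An interval in the limit set lies in a single piece, since the pieces are closed and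
  disjoint. It is thus a contracted copy of another interval in the limit set. Letting m grow gives
  total disconnectedness.\<close>

lemma limit_set_interval_short:
  assumes "{x..y} \<subseteq> limit_set" "x \<le> y"
  shows "y - x \<le> \<rho> ^ m * (q - p)"
  using assms
proof (induction m arbitrary: x y)
  case 0
  then have "x \<in> limit_set" "y \<in> limit_set" by auto
  then have "x \<in> {p..q}" "y \<in> {p..q}" using limit_set_subset(2) by blast+
  then show ?case by auto
next
  case (Suc m)
  then have x: "x \<in> limit_set" by auto
  obtain i x' where i: "i < r" "x' \<in> limit_set" "x = g i x'" using limit_set_cases[OF x] by metis
  define B where "B = (\<Union>j\<in>{..<r} - {i}. g j ` {p..q})"
  have cl: "closed (g i ` {p..q})" "closed B"
    unfolding B_def using closed_branch_image i by (auto intro!: closed_UN)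
  have cover: "{x..y} \<subseteq> g i ` {p..q} \<union> B"
    using Suc.prems(1) limit_set_subset(1) unfolding B_def images_def by blast
  have disjB: "g i ` {p..q} \<inter> B = {}" using disj i by (fastforce simp: B_def)
  have "x \<in> g i ` {p..q}" using i limit_set_subset by blast
  then have "B \<inter> {x..y} = {}"
    using connected_closedD[OF connected_Icc[of x y], of "g i ` {p..q}" B] cl cover disjB Suc.prems(2) by auto
  then have "{x..y} \<subseteq> g i ` {p..q}" using cover by blast
  moreover have "y \<in> {x..y}" using Suc.prems by simp
  ultimately obtain y' where y': "y' \<in> {p..q}" "y = g i y'" by blast
  have x': "x' \<in> {p..q}" using i limit_set_subset by blast
  have le: "x' \<le> y'" using branch_less_iff[OF i(1) x' y'(1)] i y' Suc.prems by simp
  have "{x'..y'} \<subseteq> limit_set"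
  proof
    fix z assume z: "z \<in> {x'..y'}"
    then have zpq: "z \<in> {p..q}" using x' y' by auto
    have "g i z \<in> {x..y}" using branch_mono[OF i(1)] zpq x' y' z i by auto
    then have "\<psi> (g i z) \<in> limit_set" using Suc.prems psi_limit_set by blast
    then show "z \<in> limit_set" using inverse[OF i(1) zpq] by simp
  qed
  from Suc.IH[OF this le] have "y' - x' \<le> \<rho> ^ m * (q - p)" .
  then have "\<rho> * \<bar>y' - x'\<bar> \<le> \<rho> * (\<rho> ^ m * (q - p))"
    using \<rho> le by (intro mult_left_mono) auto
  moreover have "y - x \<le> \<rho> * \<bar>y' - x'\<bar>"
    using branch_abs_contr[OF i(1) y'(1) x'] y' i by simp
  ultimately show ?case by (simp add: mult.assoc)
qed

lemma contraction_powers_tendsto_0: "(\<lambda>m. \<rho> ^ m * (q - p)) \<longlonglongrightarrow> 0"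
  by (intro tendsto_mult_left_zero LIMSEQ_power_zero) (use \<rho> in auto)

lemma cantor_limit_set:
  assumes "u \<in> limit_set" "v \<in> limit_set" "u \<noteq> v"
  shows "cantor_set limit_set"
  unfolding cantor_set_def
proof (intro conjI ballI)
  show "limit_set \<noteq> {}" using assms by blast
  show "compact limit_set" by (rule compact_limit_set)
next
  fix x assume x: "x \<in> limit_set"
  show "x islimpt limit_set"
    unfolding islimpt_approachable
  proof (intro allI impI)
    fix e :: real assume "0 < e"
    then obtain m where "\<rho> ^ m * (q - p) < e"
      using contraction_powers_tendsto_0 by (metis (no_types, lifting) eventually_sequentially le_refl order_tendstoD(2))
    then show "\<exists>x'\<in>limit_set. x' \<noteq> x \<and> dist x' x < e"
      using limit_set_nearby[OF assms x, of m] by (auto simp: dist_real_def)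
  qed
next
  fix x assume x: "x \<in> limit_set"
  have eq: "y = z" if "{y..z} \<subseteq> limit_set" "y \<le> z" for y z
  proof -
    have "z - y \<le> 0"
      using tendsto_lowerbound[OF contraction_powers_tendsto_0, of "z - y"] limit_set_interval_short[OF that] by simp
    then show ?thesis using that by simp
  qed
  have "y = x" if y: "y \<in> connected_component_set limit_set x" for y
  proof -
    obtain T where T: "connected T" "T \<subseteq> limit_set" "x \<in> T" "y \<in> T"
      using y by (auto simp: connected_component_def)
    have "{x..y} \<subseteq> limit_set" "{y..x} \<subseteq> limit_set"
      using T connected_contains_Icc by blast+
    then show ?thesis using eq by (metis linear)
  qed
  then show "connected_component_set limit_set x = {x}" using x by auto
qed

text \<open>The intervals are the images of the hull {a..b} of the limit set and not of {p..q},
  because their endpoints must belong to the Cantor set. Each is mapped by \<psi> onto {a..b}, so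
  the index set in the hull condition is always {..<r}.\<close>

lemma regular_cantor_limit_set:
  assumes uv: "u \<in> limit_set" "v \<in> limit_set" "u \<noteq> v"
    and U: "open U" "images \<subseteq> U" "0 < \<epsilon>" "\<epsilon> \<le> 1" "C1_Hoelder_on \<epsilon> U \<psi>" "expanding_on U \<psi>"
  obtains a b where "regular_cantor_set limit_set r a b \<psi>" "\<And>j. j < r \<Longrightarrow> {a j..b j} \<subseteq> g j ` {p..q}"
proof -
  have ne: "limit_set \<noteq> {}" using uv by blast
  obtain a where a: "a \<in> limit_set" "\<And>x. x \<in> limit_set \<Longrightarrow> a \<le> x"
    using compact_attains_inf[OF compact_limit_set ne] by blast
  obtain b where b: "b \<in> limit_set" "\<And>x. x \<in> limit_set \<Longrightarrow> x \<le> b"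
    using compact_attains_sup[OF compact_limit_set ne] by blast
  have ab: "a < b" using a(2)[OF uv(1)] a(2)[OF uv(2)] b(2)[OF uv(1)] b(2)[OF uv(2)] uv(3) by linarith
  have apq: "a \<in> {p..q}" "b \<in> {p..q}" using a b limit_set_subset by blast+
  have im: "g j ` {a..b} = {g j a..g j b}" if "j < r" for j
    using branch_image[OF that, of a b] apq ab by auto
  have sub: "{g j a..g j b} \<subseteq> g j ` {p..q}" if "j < r" for j
    unfolding im[OF that, symmetric] using apq by (intro image_mono) auto
  have sub_images: "(\<Union>j<r. {g j a..g j b}) \<subseteq> images"
    unfolding images_def by (intro UN_mono sub) auto
  have cover: "limit_set \<subseteq> (\<Union>j<r. {g j a..g j b})"
  proof
    fix x assume "x \<in> limit_set"
    then obtain j y where j: "j < r" "y \<in> limit_set" "x = g j y" by (metis limit_set_cases)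
    then have "y \<in> {a..b}" using a b by auto
    then have "x \<in> {g j a..g j b}" using im[OF j(1)] j(3) by blast
    then show "x \<in> (\<Union>j<r. {g j a..g j b})" using j(1) by blast
  qed
  have psi_im: "\<psi> ` {g j a..g j b} = {a..b}" if "j < r" for j
  proof -
    have "\<psi> ` g j ` {a..b} = (\<lambda>x. x) ` {a..b}"
      unfolding image_image by (rule image_cong) (use inverse[OF that] apq in auto)
    then show ?thesis using im[OF that] by simp
  qed
  have hull: "convex hull (\<Union>s<r. {g s a..g s b}) = {a..b}"
  proof
    have "{g s a..g s b} \<subseteq> {a..b}" if "s < r" for s
      using a(2)[OF branch_limit_set[OF that a(1)]] b(2)[OF branch_limit_set[OF that b(1)]] by auto
    then show "convex hull (\<Union>s<r. {g s a..g s b}) \<subseteq> {a..b}"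
      by (intro hull_minimal UN_least) (blast, simp)
    have "limit_set \<subseteq> convex hull (\<Union>s<r. {g s a..g s b})"
      using cover hull_subset order_trans by metis
    then have "closed_segment a b \<subseteq> convex hull (\<Union>s<r. {g s a..g s b})"
      using a(1) b(1) by (intro closed_segment_subset) auto
    then show "{a..b} \<subseteq> convex hull (\<Union>s<r. {g s a..g s b})"
      using ab by (simp add: closed_segment_eq_real_ivl)
  qed
  have iter: "(\<psi> ^^ n) ` (limit_set \<inter> {g j a..g j b}) = limit_set" if j: "j < r" and n: "n \<ge> 1" for j n
  proof -
    have surj: "\<psi> ` (limit_set \<inter> {g j a..g j b}) = limit_set"
    proof
      show "\<psi> ` (limit_set \<inter> {g j a..g j b}) \<subseteq> limit_set" using psi_limit_set by blast
      show "limit_set \<subseteq> \<psi> ` (limit_set \<inter> {g j a..g j b})"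
      proof
        fix y assume y: "y \<in> limit_set"
        then have "y \<in> {a..b}" using a b by auto
        then have "g j y \<in> limit_set \<inter> {g j a..g j b}" using branch_limit_set[OF j y] im[OF j] by blast
        moreover have "\<psi> (g j y) = y" using inverse[OF j] y limit_set_subset by blast
        ultimately show "y \<in> \<psi> ` (limit_set \<inter> {g j a..g j b})" by (metis imageI)
      qed
    qed
    have inv: "\<psi> ` limit_set = limit_set"
      using surj psi_limit_set by blast
    have invn: "(\<psi> ^^ m) ` limit_set = limit_set" for m
    proof (induction m)
      case (Suc m)
      have "(\<psi> ^^ Suc m) ` limit_set = \<psi> ` (\<psi> ^^ m) ` limit_set" by (simp add: image_image)
      then show ?case using Suc inv by simp
    qed simp
    obtain m where "n = Suc m" using n by (cases n) auto
    then have "(\<psi> ^^ n) ` S = (\<psi> ^^ m) ` \<psi> ` S" for S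
      by (simp add: image_image funpow_swap1)
    then show ?thesis using surj invn[of m] by simp
  qed
  have K_eq: "limit_set = (\<Inter>n. (\<psi> ^^ n) -` (\<Union>j<r. {g j a..g j b}))"
  proof
    have "(\<psi> ^^ n) x \<in> limit_set" if "x \<in> limit_set" for x n
      using that psi_limit_set by (induction n) auto
    then show "limit_set \<subseteq> (\<Inter>n. (\<psi> ^^ n) -` (\<Union>j<r. {g j a..g j b}))"
      using cover by blast
    have "(\<Union>j<r. {g j a..g j b}) \<subseteq> images" by (rule sub_images)
    then show "(\<Inter>n. (\<psi> ^^ n) -` (\<Union>j<r. {g j a..g j b})) \<subseteq> limit_set"
      by (fastforce simp: limit_set_def)
  qed
  have "regular_cantor_set limit_set r (\<lambda>j. g j a) (\<lambda>j. g j b) \<psi>"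
    unfolding regular_cantor_set_def
  proof (intro conjI)
    show "cantor_set limit_set" using cantor_limit_set[OF uv] .
    show "\<forall>j<r. g j a < g j b" using incr apq ab by blast
    show "disjoint_family_on (\<lambda>j. {g j a..g j b}) {..<r}"
      unfolding disjoint_family_on_def
    proof (intro ballI impI)
      fix i j assume ij: "i \<in> {..<r}" "j \<in> {..<r}" "i \<noteq> j"
      then have "g i ` {p..q} \<inter> g j ` {p..q} = {}" using disj by blast
      then show "{g i a..g i b} \<inter> {g j a..g j b} = {}"
        using sub[of i] sub[of j] ij by blast
    qed
    show "limit_set \<subseteq> (\<Union>j<r. {g j a..g j b})" by (rule cover)
    show "\<forall>j<r. frontier {g j a..g j b} \<subseteq> limit_set"
      using branch_limit_set a(1) b(1) frontier_Icc_subset by blast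
    show "\<exists>U \<epsilon>. open U \<and> (\<Union>j<r. {g j a..g j b}) \<subseteq> U \<and> 0 < \<epsilon> \<and> \<epsilon> \<le> 1 \<and>
            C1_Hoelder_on \<epsilon> U \<psi> \<and> expanding_on U \<psi>"
      using U sub_images by (intro exI[of _ U] exI[of _ \<epsilon>]) blast
    show "\<forall>j<r. \<exists>S\<subseteq>{..<r}. \<psi> ` {g j a..g j b} = convex hull (\<Union>s\<in>S. {g s a..g s b})"
      using psi_im hull by blast
    show "\<forall>j<r. \<forall>\<^sub>F n in sequentially. (\<psi> ^^ n) ` (limit_set \<inter> {g j a..g j b}) = limit_set"
      using iter unfolding eventually_sequentially by blast
    show "limit_set = (\<Inter>n. (\<psi> ^^ n) -` (\<Union>j<r. {g j a..g j b}))" by (rule K_eq)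
  qed
  then show ?thesis using that sub by blast
qed

text \<open>
  Unless some member of the cover is at least as large as the gap between the first-level pieces, each
  member meets only one piece.  The cover then splits into smaller covers of the pieces, which
  are rescaled by \<^term>\<open>\<psi>\<close>.
\<close>

lemma sum_diameter_finite_cover:
  assumes t: "0 < t" and r: "2 \<le> r" and \<mu>: "\<And>j. j < r \<Longrightarrow> 0 < \<mu> j"
    and lower: "\<And>j x y. j < r \<Longrightarrow> x \<in> {p..q} \<Longrightarrow> y \<in> {p..q} \<Longrightarrow> x < y \<Longrightarrow> \<mu> j * (y - x) \<le> g j y - g j x"
    and sum: "1 \<le> (\<Sum>j<r. \<mu> j powr t)"
    and d: "0 < d" "\<And>i j x y. i < r \<Longrightarrow> j < r \<Longrightarrow> i \<noteq> j \<Longrightarrow> x \<in> g i ` {p..q} \<Longrightarrow> y \<in> g j ` {p..q} \<Longrightarrow> d \<le> \<bar>x - y\<bar>"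
    and F: "finite (F :: nat set)" "\<And>i. i \<in> F \<Longrightarrow> bounded (G i)" "limit_set \<subseteq> (\<Union>i\<in>F. G i)"
  shows "d powr t \<le> (\<Sum>i\<in>F. diameter (G i) powr t)"
  using F
proof (induction "card F" arbitrary: F G rule: less_induct)
  case less
  show ?case
  proof (cases "\<exists>i\<in>F. d \<le> diameter (G i)")
    case True
    then obtain i where i: "i \<in> F" "d \<le> diameter (G i)" by blast
    have "d powr t \<le> diameter (G i) powr t" using i d(1) t by (intro powr_mono2) auto
    also have "\<dots> \<le> (\<Sum>i\<in>F. diameter (G i) powr t)"
      using less.prems(1) i(1) by (intro member_le_sum) auto
    finally show ?thesis .
  next
    case False
    define H where "H j = {i \<in> F. G i \<inter> g j ` limit_set \<noteq> {}}" for j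
    have HF: "H j \<subseteq> F" "finite (H j)" for j using less.prems(1) by (auto simp: H_def)
    have disjH: "H i \<inter> H j = {}" if ij: "i < r" "j < r" "i \<noteq> j" for i j
    proof (rule ccontr)
      assume "H i \<inter> H j \<noteq> {}"
      then obtain l x y where l: "l \<in> F" "x \<in> G l" "y \<in> G l" "x \<in> g i ` limit_set" "y \<in> g j ` limit_set"
        by (auto simp: H_def)
      have "d \<le> \<bar>x - y\<bar>" using d(2)[OF ij] l limit_set_subset(2) by blast
      also have "\<dots> \<le> diameter (G l)"
        using diameter_bounded_bound[OF less.prems(2)[OF l(1)] l(2,3)] by (simp add: dist_real_def)
      finally show False using False l by blast
    qed
    have neH: "H j \<noteq> {}" if "j < r" for j
    proof -
      obtain x where x: "x \<in> limit_set" using branch_meets_limit_set[OF \<open>j < r\<close>] by blast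
      then have "g j x \<in> limit_set" using branch_limit_set that by blast
      then show ?thesis using less.prems(3) x by (force simp: H_def)
    qed
    have main: "\<mu> j powr t * d powr t \<le> (\<Sum>i\<in>H j. diameter (G i) powr t)" if j: "j < r" for j
    proof -
      \<comment> \<open>Another piece needs a member of the cover that misses piece j, so
        \<open>H j\<close> is strictly smaller than F and the induction applies.\<close>
      obtain j' where j': "j' < r" "j' \<noteq> j"
        using r by (intro that[of "if j = 0 then 1 else 0"]) auto
      then have "H j \<subset> F" using disjH[OF j' (1) j j'(2)] neH[OF j'(1)] HF by blast
      then have card: "card (H j) < card F" using less.prems(1) psubset_card_mono by blast
      \<comment> \<open>Pulling back through \<open>g j\<close> enlarges diameters by at most 1 /
        \<open>\<mu> j\<close>, which the factor \<open>\<mu> j powr t\<close> compensates.\<close>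
      define G' where "G' i = {y \<in> limit_set. g j y \<in> G i}" for i
      have bd: "bounded (G' i)" for i
        by (rule bounded_subset[OF compact_imp_bounded[OF compact_limit_set]]) (auto simp: G'_def)
      have cov: "limit_set \<subseteq> (\<Union>i\<in>H j. G' i)"
      proof
        fix y assume y: "y \<in> limit_set"
        then have "g j y \<in> limit_set" using branch_limit_set j by blast
        then show "y \<in> (\<Union>i\<in>H j. G' i)" using less.prems(3) y by (fastforce simp: G'_def H_def)
      qed
      have diam: "\<mu> j * diameter (G' i) \<le> diameter (G i)" if i: "i \<in> H j" for i
      proof -
        have bG: "bounded (G i)" using less.prems(2) HF i by blast
        have "\<bar>x - y\<bar> \<le> diameter (G i) / \<mu> j" if xy: "x \<in> G' i" "y \<in> G' i" for x y
        proof -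
          have "x \<in> {p..q}" "y \<in> {p..q}" using xy limit_set_subset by (auto simp: G'_def)
          then have "\<mu> j * \<bar>x - y\<bar> \<le> \<bar>g j x - g j y\<bar>"
            using lower[OF j, of x y] lower[OF j, of y x] by (cases x y rule: linorder_cases) auto
          also have "\<dots> \<le> diameter (G i)"
            using diameter_bounded_bound[OF bG] xy by (simp add: dist_real_def G'_def)
          finally show ?thesis using \<mu>[OF j] by (simp add: field_simps)
        qed
        then have "diameter (G' i) \<le> diameter (G i) / \<mu> j"
          using diameter_ge_0[OF bG] \<mu>[OF j] by (intro diameter_le) (auto simp: less_imp_le)
        then show ?thesis using \<mu>[OF j] by (simp add: field_simps)
      qed
      have "d powr t \<le> (\<Sum>i\<in>H j. diameter (G' i) powr t)"
        using less.hyps[OF card HF(2) bd cov] .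
      then have "\<mu> j powr t * d powr t \<le> \<mu> j powr t * (\<Sum>i\<in>H j. diameter (G' i) powr t)"
        by (rule mult_left_mono) simp
      also have "\<dots> = (\<Sum>i\<in>H j. (\<mu> j * diameter (G' i)) powr t)"
        using \<mu>[OF j] bd by (simp add: sum_distrib_left powr_mult diameter_ge_0)
      also have "\<dots> \<le> (\<Sum>i\<in>H j. diameter (G i) powr t)"
        using \<mu>[OF j] bd t diam by (intro sum_mono powr_mono2) (auto simp: diameter_ge_0)
      finally show ?thesis .
    qed
    have "d powr t \<le> (\<Sum>j<r. \<mu> j powr t) * d powr t"
      using mult_right_mono[OF sum, of "d powr t"] by simp
    also have "\<dots> \<le> (\<Sum>j<r. \<Sum>i\<in>H j. diameter (G i) powr t)"
      unfolding sum_distrib_right by (intro sum_mono) (use main in auto)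
    also have "\<dots> = (\<Sum>i\<in>(\<Union>j<r. H j). diameter (G i) powr t)"
      using HF disjH by (intro sum.UNION_disjoint[symmetric]) auto
    also have "\<dots> \<le> (\<Sum>i\<in>F. diameter (G i) powr t)"
      using HF less.prems(1) by (intro sum_mono2) auto
    finally show ?thesis .
  qed
qed

text \<open>The ratios \<open>\<mu> j\<close> are at most 1, so for t < s the sum with exponent t is
  still at least 1, and the estimate for finite covers makes the t-dimensional measure
  positive.\<close>

lemma hausdorff_dim_limit_set_ge:
  assumes r: "2 \<le> r" and \<mu>: "\<And>j. j < r \<Longrightarrow> 0 < \<mu> j"
    and lower: "\<And>j x y. j < r \<Longrightarrow> x \<in> {p..q} \<Longrightarrow> y \<in> {p..q} \<Longrightarrow> x < y \<Longrightarrow> \<mu> j * (y - x) \<le> g j y - g j x"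
    and sum: "1 \<le> (\<Sum>j<r. \<mu> j powr s)"
  shows "ereal s \<le> hausdorff_dim limit_set"
  unfolding hausdorff_dim_def
proof (rule Inf_greatest, safe)
  fix t :: real assume t: "0 < t" "hausdorff_measure t limit_set = 0"
  show "ereal s \<le> ereal t"
  proof (rule ccontr)
    assume "\<not> ereal s \<le> ereal t"
    then have ts: "t \<le> s" by simp
    have le1: "\<mu> j \<le> 1" if "j < r" for j
    proof -
      have "\<mu> j * (q - p) \<le> g j q - g j p" using lower[OF that, of p q] pq by simp
      also have "\<dots> \<le> \<rho> * (q - p)" using contr[OF that, of p q] pq by simp
      finally have "\<mu> j * (q - p) \<le> \<rho> * (q - p)" .
      then have "\<mu> j \<le> \<rho>" using pq mult_le_cancel_right_pos[of "q - p"] by auto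
      then show ?thesis using \<rho> by simp
    qed
    have "(\<Sum>j<r. \<mu> j powr s) \<le> (\<Sum>j<r. \<mu> j powr t)"
      using \<mu> le1 ts by (intro sum_mono powr_mono') (auto simp: less_imp_le)
    then have sum_t: "1 \<le> (\<Sum>j<r. \<mu> j powr t)" using sum by simp
    obtain d where d: "0 < d"
      "\<And>i j x y. i < r \<Longrightarrow> j < r \<Longrightarrow> i \<noteq> j \<Longrightarrow> x \<in> g i ` {p..q} \<Longrightarrow> y \<in> g j ` {p..q} \<Longrightarrow> d \<le> \<bar>x - y\<bar>"
      using images_gap by metis
    have "hausdorff_measure t limit_set \<noteq> 0"
      by (rule hausdorff_measure_compact_pos[OF compact_limit_set t(1), of "d powr t"])
        (use d(1) sum_diameter_finite_cover[OF t(1) r \<mu> lower sum_t d] in auto)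
    then show False using t by simp
  qed
qed

end

subsection \<open>Inverse branches\<close>

text \<open>\<open>slope\<close> is the derivative condition at 1/2, where the slope is least;
  \<open>range\<close> says f(1/2) < 1/2.\<close>

locale odd_lorenz =
  fixes \<alpha> \<theta> :: real and f :: "real \<Rightarrow> real"
  assumes \<alpha>: "0 < \<alpha>" "\<alpha> < 1"
    and slope: "sqrt 2 < \<alpha> * \<theta> * (1/2) powr (\<alpha> - 1)"
    and range: "\<theta> * (1/2) powr \<alpha> < 1"
    and f_pos: "0 < x \<Longrightarrow> x \<le> 1/2 \<Longrightarrow> f x = \<theta> * x powr \<alpha> - 1/2"
    and f_neg: "-1/2 \<le> x \<Longrightarrow> x < 0 \<Longrightarrow> f x = 1/2 - \<theta> * (-x) powr \<alpha>"
begin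

definition "\<sigma> = \<alpha> * \<theta> * (1/2) powr (\<alpha> - 1)"

text \<open>\<open>True\<close> stands for the left half. Multiplication by \<open>sg b\<close>
  reflects it to the right half, so each argument is made once for both branches.\<close>

definition "sg b = (if b then -1 else 1 :: real)"

definition "F x = \<theta> * x powr \<alpha> - 1/2"

text \<open>Inverse of \<open>F\<close>, continued by 0 below -1/2 and by the same formula above
  F(1/2), where its values exceed 1/2. Total continuous branches spare all later inductions the
  bookkeeping of domains.\<close>

definition "inv0 y = (max (y + 1/2) 0 / \<theta>) powr (1 / \<alpha>)"

definition "br b y = sg b * inv0 (sg b * y)"

text \<open>
  The derivative of \<^term>\<open>br b\<close> at \<open>y\<close> is \<open>wt (br b y)\<close> as long as the image stays in
  \<^term>\<open>lorenz_interval\<close>.  Cutting the weight off outside makes it bounded; the important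
  point is that it is continuous and vanishes at the discontinuity of \<^term>\<open>f\<close>.
\<close>

definition "wt x = min \<bar>x\<bar> (1/2) powr (1 - \<alpha>) / (\<alpha> * \<theta>)"

lemma sg_simps [simp]: "sg b * sg b = 1" "sg b * (sg b * x) = x" "\<bar>sg b * x\<bar> = \<bar>x\<bar>" "sg b \<noteq> 0"
  "sg True = -1" "sg False = 1"
  by (auto simp: sg_def)

lemma f_eq: "0 < sg b * x \<Longrightarrow> sg b * x \<le> 1/2 \<Longrightarrow> f x = sg b * F (sg b * x)"
  using f_pos[of x] f_neg[of x] by (cases b) (auto simp: F_def)

lemma \<sigma>: "sqrt 2 < \<sigma>" "5/4 < \<sigma>" "2 < \<sigma>\<^sup>2"
proof -
  show *: "sqrt 2 < \<sigma>" using slope by (simp add: \<sigma>_def)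
  have "5/4 < sqrt 2" by (rule real_less_rsqrt) (simp add: power2_eq_square)
  then show "5/4 < \<sigma>" using * by simp
  have "(sqrt 2)\<^sup>2 < \<sigma>\<^sup>2" using * by (intro power_strict_mono) auto
  then show "2 < \<sigma>\<^sup>2" by simp
qed

lemma \<theta>_pos: "0 < \<theta>"
proof (rule ccontr)
  assume "\<not> 0 < \<theta>"
  then have "\<sigma> \<le> 0" using \<alpha> unfolding \<sigma>_def by (intro mult_nonpos_nonneg mult_nonneg_nonpos) auto
  then show False using \<sigma> by simp
qed

text \<open>The chord slope over [0,1/2] is at least the slope \<sigma> at the right end, so F(1/2)
  + 1/2 \<ge> \<sigma>/2 > 1/2. Hence the image of each half reaches across 0.\<close>

lemma F_half: "1/2 < F (1/2) + 1/2" "F (1/2) < 1/2" "0 < F (1/2)"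
proof -
  have "\<sigma> = 2 * \<alpha> * (\<theta> * (1/2) powr \<alpha>)" by (simp add: \<sigma>_def powr_diff)
  also have "\<dots> \<le> 2 * (\<theta> * (1/2) powr \<alpha>)" using \<alpha> \<theta>_pos by (intro mult_right_mono) auto
  finally show "1/2 < F (1/2) + 1/2" "0 < F (1/2)" using \<sigma> by (simp_all add: F_def)
  show "F (1/2) < 1/2" using range by (simp add: F_def)
qed

lemma F_0 [simp]: "F 0 = -1/2"
  using \<alpha> by (simp add: F_def)

lemma inv0_nonneg [simp]: "0 \<le> inv0 y"
  by (simp add: inv0_def)

lemma inv0_eq_0 [simp]: "y \<le> -1/2 \<Longrightarrow> inv0 y = 0"
  by (simp add: inv0_def)

lemma inv0_pos: "-1/2 < y \<Longrightarrow> 0 < inv0 y"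
  using \<theta>_pos by (simp add: inv0_def)

lemma F_inv0: "-1/2 \<le> y \<Longrightarrow> F (inv0 y) = y"
  using \<theta>_pos \<alpha> by (simp add: inv0_def F_def powr_powr)

lemma F_strict_mono: "0 \<le> x \<Longrightarrow> x < y \<Longrightarrow> F x < F y"
  using \<theta>_pos \<alpha> by (auto simp: F_def powr_less_mono2)

lemma F_mono: "0 \<le> x \<Longrightarrow> x \<le> y \<Longrightarrow> F x \<le> F y"
  using F_strict_mono[of x y] by (cases "x = y") auto

lemma inv0_F: "0 \<le> x \<Longrightarrow> inv0 (F x) = x"
  using \<theta>_pos \<alpha> by (simp add: inv0_def F_def powr_powr)

lemma inv0_mono: "x \<le> y \<Longrightarrow> inv0 x \<le> inv0 y"
  unfolding inv0_def using \<theta>_pos \<alpha> by (intro powr_mono2 divide_right_mono) auto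

lemma inv0_strict_mono: "-1/2 \<le> x \<Longrightarrow> x < y \<Longrightarrow> inv0 x < inv0 y"
  unfolding inv0_def using \<theta>_pos \<alpha> by (intro powr_less_mono2 divide_strict_right_mono) auto

lemma continuous_inv0: "continuous_on S inv0"
  unfolding inv0_def using \<theta>_pos \<alpha> by (intro continuous_on_powr' continuous_intros) auto

lemma continuous_br: "continuous_on S (br b)"
  unfolding br_def by (intro continuous_intros continuous_on_compose2[OF continuous_inv0[of UNIV]]) auto

lemma inv0_half: "1/2 \<le> y \<Longrightarrow> 1/2 \<le> inv0 y"
  using inv0_mono[of "F (1/2)" y] F_half inv0_F[of "1/2"] by simp

lemma br_outside:
  assumes "\<bar>y\<bar> \<ge> 1/2"
  shows "br b y = 0 \<or> \<bar>br b y\<bar> \<ge> 1/2"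
proof -
  have "sg b * y \<le> -1/2 \<or> 1/2 \<le> sg b * y" using assms by (auto simp: sg_def)
  then show ?thesis using inv0_half[of "sg b * y"] by (auto simp: br_def)
qed

lemma wt_nonneg: "0 \<le> wt x"
  using \<theta>_pos \<alpha> by (simp add: wt_def)

lemma wt_0 [simp]: "wt 0 = 0"
  by (simp add: wt_def)

lemma wt_sg [simp]: "wt (sg b * x) = wt x" "wt (- x) = wt x"
  by (simp_all add: wt_def)

lemma wt_pos: "x \<noteq> 0 \<Longrightarrow> 0 < wt x"
  using \<theta>_pos \<alpha> by (simp add: wt_def min_def)

lemma wt_mono: "\<bar>x\<bar> \<le> \<bar>y\<bar> \<Longrightarrow> wt x \<le> wt y"
  unfolding wt_def using \<theta>_pos \<alpha> by (intro divide_right_mono powr_mono2) auto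

lemma wt_le: "wt x \<le> 1 / \<sigma>"
proof -
  have "wt x \<le> (1/2) powr (1 - \<alpha>) / (\<alpha> * \<theta>)"
    unfolding wt_def using \<theta>_pos \<alpha> by (intro divide_right_mono powr_mono2) auto
  also have "(1/2) powr (1 - \<alpha>) = 1 / (1/2) powr (\<alpha> - 1 :: real)"
    using powr_minus_divide[of "1/2" "\<alpha> - 1"] by simp
  finally show ?thesis by (simp add: \<sigma>_def mult.commute)
qed

lemma wt_le': "wt x \<le> 4/5"
proof -
  have "1 / \<sigma> \<le> 4/5" using \<sigma>(2) by (simp add: field_simps)
  then show ?thesis using wt_le[of x] by linarith
qed

lemma continuous_wt: "continuous_on S wt"
  unfolding wt_def using \<theta>_pos \<alpha> by (intro continuous_on_divide continuous_on_powr' continuous_intros) auto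

lemma wt_lipschitz:
  assumes "0 < \<delta>"
  obtains L where "0 < L" "\<And>x y. 0 \<le> x \<Longrightarrow> x \<le> y \<Longrightarrow> wt (max y \<delta>) - wt (max x \<delta>) \<le> L * (y - x)"
proof -
  define L where "L = (1 - \<alpha>) * \<delta> powr (- \<alpha>) / (\<alpha> * \<theta>)"
  have L: "0 < L" using assms \<alpha> \<theta>_pos by (simp add: L_def)
  have *: "v powr (1 - \<alpha>) / (\<alpha> * \<theta>) - u powr (1 - \<alpha>) / (\<alpha> * \<theta>) \<le> L * (v - u)" if uv: "\<delta> \<le> u" "u < v" for u v
  proof -
    have der: "((\<lambda>z. z powr (1 - \<alpha>) / (\<alpha> * \<theta>)) has_real_derivative (1 - \<alpha>) * z powr (- \<alpha>) / (\<alpha> * \<theta>)) (at z)"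
      if "u \<le> z" for z
      using that uv assms \<alpha> \<theta>_pos by (auto intro!: derivative_eq_intros)
    then obtain z where z: "u < z" "z < v"
      "v powr (1 - \<alpha>) / (\<alpha> * \<theta>) - u powr (1 - \<alpha>) / (\<alpha> * \<theta>) = (v - u) * ((1 - \<alpha>) * z powr (- \<alpha>) / (\<alpha> * \<theta>))"
      using MVT2[OF uv(2), of "\<lambda>z. z powr (1 - \<alpha>) / (\<alpha> * \<theta>)" "\<lambda>z. (1 - \<alpha>) * z powr (- \<alpha>) / (\<alpha> * \<theta>)"] by blast
    have "z powr (- \<alpha>) \<le> \<delta> powr (- \<alpha>)" using z uv assms \<alpha> by (intro powr_mono2') auto
    then have "(1 - \<alpha>) * z powr (- \<alpha>) / (\<alpha> * \<theta>) \<le> L"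
      unfolding L_def using \<alpha> \<theta>_pos by (intro divide_right_mono mult_left_mono) auto
    then have "(v - u) * ((1 - \<alpha>) * z powr (- \<alpha>) / (\<alpha> * \<theta>)) \<le> (v - u) * L"
      using uv by (intro mult_left_mono) auto
    then show ?thesis unfolding z(3) by (simp add: mult.commute)
  qed
  show ?thesis
  proof (rule that[OF L])
    fix x y :: real assume xy: "0 \<le> x" "x \<le> y"
    define u where "u = min (max x \<delta>) (1/2)"
    define v where "v = min (max y \<delta>) (1/2)"
    have uv: "wt (max x \<delta>) = u powr (1 - \<alpha>) / (\<alpha> * \<theta>)" "wt (max y \<delta>) = v powr (1 - \<alpha>) / (\<alpha> * \<theta>)"
      using assms by (simp_all add: wt_def u_def v_def)
    \<comment> \<open>If \<delta> exceeds 1/2, the cap makes u and v both equal to 1/2.\<close>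
    have "u \<le> v" "v - u \<le> y - x" "\<delta> \<le> u \<or> u = v" using xy by (auto simp: u_def v_def)
    then have "wt (max y \<delta>) - wt (max x \<delta>) \<le> L * (v - u)"
      unfolding uv using *[of u v] by (cases "u = v") auto
    also have "\<dots> \<le> L * (y - x)" using \<open>v - u \<le> y - x\<close> L by (intro mult_left_mono) auto
    finally show "wt (max y \<delta>) - wt (max x \<delta>) \<le> L * (y - x)" .
  qed
qed

lemma inv0_deriv:
  assumes "-1/2 < y"
  shows "(inv0 has_real_derivative inv0 y powr (1 - \<alpha>) / (\<alpha> * \<theta>)) (at y)"
proof -
  have "((\<lambda>y. ((y + 1/2) / \<theta>) powr (1 / \<alpha>)) has_real_derivative
      (1 / \<alpha>) * ((y + 1/2) / \<theta>) powr (1 / \<alpha> - 1) * (1 / \<theta>)) (at y)"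
    using assms \<theta>_pos by (auto intro!: derivative_eq_intros)
  also have "(1 / \<alpha>) * ((y + 1/2) / \<theta>) powr (1 / \<alpha> - 1) * (1 / \<theta>) = inv0 y powr (1 - \<alpha>) / (\<alpha> * \<theta>)"
    using assms \<alpha> by (simp add: inv0_def powr_powr diff_divide_distrib)
  finally have "((\<lambda>y. ((y + 1/2) / \<theta>) powr (1 / \<alpha>)) has_real_derivative inv0 y powr (1 - \<alpha>) / (\<alpha> * \<theta>)) (at y)" .
  then show ?thesis
    by (rule has_field_derivative_transform_within_open[of _ _ _ "{-1/2<..}"]) (use assms in \<open>auto simp: inv0_def\<close>)
qed

lemma br_deriv:
  assumes "-1/2 < sg b * y" "\<bar>br b y\<bar> \<le> 1/2"
  shows "(br b has_real_derivative wt (br b y)) (at y)"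
proof -
  have "((\<lambda>y. sg b * inv0 (sg b * y)) has_real_derivative
      sg b * ((inv0 (sg b * y) powr (1 - \<alpha>) / (\<alpha> * \<theta>)) * sg b)) (at y)"
    by (intro DERIV_cmult DERIV_chain2[where f=inv0 and g="\<lambda>y. sg b * y", OF inv0_deriv[OF assms(1)]])
      (auto intro!: derivative_eq_intros)
  moreover have "sg b * ((inv0 (sg b * y) powr (1 - \<alpha>) / (\<alpha> * \<theta>)) * sg b) = wt (br b y)"
    using assms(2) by (simp add: wt_def br_def sg_def min_def)
  ultimately show ?thesis unfolding br_def[abs_def] by simp
qed

lemma f_br:
  assumes "br b y \<noteq> 0" "\<bar>br b y\<bar> \<le> 1/2"
  shows "f (br b y) = y"
proof -
  have y: "-1/2 < sg b * y"
    using assms(1) inv0_eq_0[of "sg b * y"] by (cases "sg b * y \<le> -1/2") (auto simp: br_def)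
  have "0 < sg b * br b y" using inv0_pos[OF y] by (simp add: br_def)
  moreover have "sg b * br b y \<le> 1/2" using assms(2) by (simp add: br_def)
  ultimately show ?thesis using f_eq[of b "br b y"] F_inv0[of "sg b * y"] y by (simp add: br_def)
qed

lemma br_side: "br b y \<noteq> 0 \<Longrightarrow> 0 < sg b * br b y"
  using inv0_nonneg[of "sg b * y"] by (auto simp: br_def less_le)

subsection \<open>A Lasota--Yorke inequality\<close>

text \<open>A bound M for the total variation, carried by a monotone dominating function v.
  Reparametrising by a monotone map and gluing local estimates then only mean operating on
  v.\<close>

definition bv :: "(real \<Rightarrow> real) \<Rightarrow> real \<Rightarrow> bool" where
  "bv \<phi> M \<longleftrightarrow> (\<exists>v. mono v \<and> (\<forall>x. 0 \<le> v x \<and> v x \<le> M) \<and> (\<forall>x y. x \<le> y \<longrightarrow> \<bar>\<phi> y - \<phi> x\<bar> \<le> v y - v x))"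

text \<open>Telescoping over steps of length \<kappa>. The Lasota--Yorke estimate then has to be
  proved for nearby points only.\<close>

lemma dominated_if_locally_dominated:
  fixes h V :: "real \<Rightarrow> real"
  assumes \<kappa>: "0 < \<kappa>"
    and loc: "\<And>x y. 0 \<le> x \<Longrightarrow> x \<le> y \<Longrightarrow> y \<le> x + \<kappa> \<Longrightarrow> \<bar>h y - h x\<bar> \<le> V y - V x"
    and xy: "0 \<le> x" "x \<le> y"
  shows "\<bar>h y - h x\<bar> \<le> V y - V x"
proof -
  have *: "\<bar>h y - h x\<bar> \<le> V y - V x" if "0 \<le> x" "x \<le> y" "y \<le> x + real n * \<kappa>" for n x y
    using that
  proof (induction n arbitrary: y)
    case 0
    then show ?case by simp
  next
    case (Suc n)
    show ?case
    proof (cases "y \<le> x + \<kappa>")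
      case True
      then show ?thesis using loc Suc.prems by blast
    next
      case False
      have "\<bar>h (y - \<kappa>) - h x\<bar> \<le> V (y - \<kappa>) - V x"
        using Suc False by (auto simp: algebra_simps)
      moreover have "\<bar>h y - h (y - \<kappa>)\<bar> \<le> V y - V (y - \<kappa>)"
        using False Suc.prems \<kappa> by (intro loc) auto
      ultimately show ?thesis by linarith
    qed
  qed
  obtain n where "(y - x) / \<kappa> \<le> real n" using real_arch_simple by blast
  then show ?thesis using \<kappa> xy by (intro *[of _ _ n]) (auto simp: field_simps)
qed

text \<open>G acts as a primitive of \<phi>. Increments of \<phi> are multiplied by at most 4/5,
  because 1/\<sigma> < 4/5. On [0,\<delta>] the weight rises from 0 to at most 1/32, which costs
  M/32. Beyond \<delta> it is L-Lipschitz, and L times \<open>\<phi> x * (y - x)\<close> is at most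
  L times the integral of \<phi> plus 3/40 of the increment of v. The factor is 7/8 = 4/5 +
  3/40.\<close>

lemma lasota_yorke_half:
  assumes \<delta>: "0 < \<delta>" "wt \<delta> \<le> 1/32"
    and L: "0 < L" "\<And>x y. 0 \<le> x \<Longrightarrow> x \<le> y \<Longrightarrow> wt (max y \<delta>) - wt (max x \<delta>) \<le> L * (y - x)"
    and \<phi>: "\<And>x. 0 \<le> \<phi> x" "\<And>x. \<phi> x \<le> M"
    and v: "mono v" "\<And>x. v x \<le> M" "\<And>x y. x \<le> y \<Longrightarrow> \<bar>\<phi> y - \<phi> x\<bar> \<le> v y - v x"
    and G: "\<And>x y m. x \<le> y \<Longrightarrow> 0 \<le> m \<Longrightarrow> (\<And>z. x \<le> z \<Longrightarrow> z \<le> y \<Longrightarrow> m \<le> \<phi> z) \<Longrightarrow> m * (y - x) \<le> G y - G x"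
    and Gt: "\<And>x. G x \<le> Gt"
  shows "bv (\<lambda>y. \<phi> (inv0 y) * wt (inv0 y)) (7/8 * (M - v 0) + L * (Gt - G 0) + M / 32)"
proof -
  \<comment> \<open>Chosen so that \<open>L * \<kappa>\<close> = 3/40 = 7/8 - 4/5.\<close>
  define \<kappa> where "\<kappa> = 3 / (40 * L)"
  have \<kappa>: "0 < \<kappa>" "L * \<kappa> = 3/40" using L by (simp_all add: \<kappa>_def)
  define V where "V x = 7/8 * v x + L * G x + M * wt (min x \<delta>)" for x
  have M: "0 \<le> M" using \<phi> order_trans by blast
  have monoG: "G x \<le> G y" if "x \<le> y" for x y using G[OF that, of 0] \<phi> by simp
  have loc: "\<bar>\<phi> y * wt y - \<phi> x * wt x\<bar> \<le> V y - V x" if xy: "0 \<le> x" "x \<le> y" "y \<le> x + \<kappa>" for x y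
  proof -
    define dv where "dv = v y - v x"
    have dv: "0 \<le> dv" using v(3)[OF xy(2)] by (simp add: dv_def)
    have split: "wt y - wt x = (wt (min y \<delta>) - wt (min x \<delta>)) + (wt (max y \<delta>) - wt (max x \<delta>))"
      by (auto simp: min_def max_def)
    have mono1: "wt (min x \<delta>) \<le> wt (min y \<delta>)" using xy \<delta> by (intro wt_mono) auto
    have mono2: "wt x \<le> wt y" using xy by (intro wt_mono) auto
    have a: "\<bar>\<phi> y - \<phi> x\<bar> * wt y \<le> dv * (4/5)"
      using v(3)[OF xy(2)] wt_le'[of y] wt_nonneg[of y] dv by (intro mult_mono) (auto simp: dv_def)
    have b: "\<phi> x * (wt (min y \<delta>) - wt (min x \<delta>)) \<le> M * (wt (min y \<delta>) - wt (min x \<delta>))"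
      using \<phi> mono1 by (intro mult_right_mono) auto
    have c: "\<phi> x * (y - x) \<le> (G y - G x) + dv * \<kappa>"
    \<comment> \<open>On [x,y] the function \<phi> is at least \<open>\<phi> x - dv\<close>; G can
      integrate this lower bound only if it is nonnegative.\<close>
    proof (cases "dv \<le> \<phi> x")
      case True
      have "(\<phi> x - dv) * (y - x) \<le> G y - G x"
      proof (rule G[OF xy(2)])
        fix z assume z: "x \<le> z" "z \<le> y"
        have "\<phi> x - \<phi> z \<le> v z - v x" using v(3)[OF z(1)] by linarith
        also have "\<dots> \<le> dv" using monoD[OF v(1) z(2)] by (simp add: dv_def)
        finally show "\<phi> x - dv \<le> \<phi> z" by linarith
      qed (use True in simp)
      moreover have "dv * (y - x) \<le> dv * \<kappa>" using dv xy by (intro mult_left_mono) auto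
      ultimately show ?thesis by (simp add: algebra_simps)
    next
      case False
      have "\<phi> x * (y - x) \<le> dv * \<kappa>" using False xy \<phi> dv by (intro mult_mono) auto
      then show ?thesis using monoG[OF xy(2)] by simp
    qed
    have d: "\<phi> x * (wt (max y \<delta>) - wt (max x \<delta>)) \<le> L * (G y - G x) + dv * (3/40)"
    proof -
      have "\<phi> x * (wt (max y \<delta>) - wt (max x \<delta>)) \<le> \<phi> x * (L * (y - x))"
        using L(2)[OF xy(1,2)] \<phi> by (intro mult_left_mono) auto
      also have "\<dots> = L * (\<phi> x * (y - x))" by simp
      also have "\<dots> \<le> L * ((G y - G x) + dv * \<kappa>)" using c L by (intro mult_left_mono) auto
      also have "\<dots> = L * (G y - G x) + dv * (L * \<kappa>)" by (simp add: algebra_simps)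
      finally show ?thesis by (simp add: \<kappa>)
    qed
    have "\<phi> y * wt y - \<phi> x * wt x = (\<phi> y - \<phi> x) * wt y + \<phi> x * (wt y - wt x)" by (simp add: algebra_simps)
    then have "\<bar>\<phi> y * wt y - \<phi> x * wt x\<bar> \<le> \<bar>\<phi> y - \<phi> x\<bar> * wt y + \<phi> x * (wt y - wt x)"
      using abs_triangle_ineq[of "(\<phi> y - \<phi> x) * wt y" "\<phi> x * (wt y - wt x)"] \<phi>(1)[of x] wt_nonneg[of y] mono2
      by (simp add: abs_mult)
    also have "\<phi> x * (wt y - wt x) = \<phi> x * (wt (min y \<delta>) - wt (min x \<delta>)) + \<phi> x * (wt (max y \<delta>) - wt (max x \<delta>))"
      unfolding split by (simp add: distrib_left)
    finally have "\<bar>\<phi> y * wt y - \<phi> x * wt x\<bar> \<le> dv * (4/5) + (M * (wt (min y \<delta>) - wt (min x \<delta>))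
        + (L * (G y - G x) + dv * (3/40)))"
      using a b d by linarith
    moreover have "V y - V x = 7/8 * dv + L * (G y - G x) + M * (wt (min y \<delta>) - wt (min x \<delta>))"
      by (simp add: V_def dv_def right_diff_distrib)
    ultimately show ?thesis by linarith
  qed
  have dom: "\<bar>\<phi> y * wt y - \<phi> x * wt x\<bar> \<le> V y - V x" if "0 \<le> x" "x \<le> y" for x y
    using dominated_if_locally_dominated[OF \<kappa>(1) loc that] .
  show ?thesis unfolding bv_def
  proof (intro exI[of _ "\<lambda>y. V (inv0 y) - V 0"] conjI allI impI)
    show "mono (\<lambda>y. V (inv0 y) - V 0)"
      by (rule monoI) (use dom[OF inv0_nonneg inv0_mono] in fastforce)
    show "0 \<le> V (inv0 x) - V 0" for x using dom[of 0 "inv0 x"] by simp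
    show "V (inv0 x) - V 0 \<le> 7/8 * (M - v 0) + L * (Gt - G 0) + M / 32" for x
    proof -
      have "wt (min (inv0 x) \<delta>) \<le> wt \<delta>" using \<delta> by (intro wt_mono) auto
      then have "M * wt (min (inv0 x) \<delta>) \<le> M * (1/32)" using \<delta> M by (intro mult_left_mono) auto
      moreover have "L * G (inv0 x) \<le> L * Gt" using Gt L by (intro mult_left_mono) auto
      moreover have "M * wt (min 0 \<delta>) = 0" using \<delta> by simp
      ultimately show ?thesis using v(2)[of "inv0 x"] unfolding V_def right_diff_distrib by linarith
    qed
    show "\<bar>\<phi> (inv0 y) * wt (inv0 y) - \<phi> (inv0 x) * wt (inv0 x)\<bar> \<le> V (inv0 y) - V 0 - (V (inv0 x) - V 0)"
      if "x \<le> y" for x y using dom[OF inv0_nonneg inv0_mono[OF that]] by simp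
  qed
qed

text \<open>The branches see the variation of \<phi> on the two sides of 0 separately, bounded by M
  - v 0 and v 0, so the main term is 7/8 M once and not twice. The two terms M/32 raise it to 15/16
  M. The left half follows by reflecting \<phi>, v and G.\<close>

lemma lasota_yorke:
  assumes \<delta>: "0 < \<delta>" "wt \<delta> \<le> 1/32"
    and L: "0 < L" "\<And>x y. 0 \<le> x \<Longrightarrow> x \<le> y \<Longrightarrow> wt (max y \<delta>) - wt (max x \<delta>) \<le> L * (y - x)"
    and \<phi>: "\<And>x. 0 \<le> \<phi> x" "\<And>x. 1/2 < \<bar>x\<bar> \<Longrightarrow> \<phi> x = 0" "bv \<phi> M"
    and G: "\<And>x y m. x \<le> y \<Longrightarrow> 0 \<le> m \<Longrightarrow> (\<And>z. x \<le> z \<Longrightarrow> z \<le> y \<Longrightarrow> m \<le> \<phi> z) \<Longrightarrow> m * (y - x) \<le> G y - G x"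
    and Gb: "\<And>x. Gb \<le> G x" and Gt: "\<And>x. G x \<le> Gt"
  obtains N where "bv (\<lambda>y. \<phi> (br False y) * wt (br False y)) (N False)" "bv (\<lambda>y. \<phi> (br True y) * wt (br True y)) (N True)"
    "N False + N True \<le> 15/16 * M + L * (Gt - Gb)"
proof -
  obtain v where v: "mono v" "\<And>x. 0 \<le> v x" "\<And>x. v x \<le> M" "\<And>x y. x \<le> y \<Longrightarrow> \<bar>\<phi> y - \<phi> x\<bar> \<le> v y - v x"
    using \<phi>(3) unfolding bv_def by blast
  \<comment> \<open>As \<phi> vanishes beyond 1/2, its variation bounds its values.\<close>
  have \<phi>M: "\<phi> x \<le> M" for x
  proof -
    have "\<phi> (max x 1) = 0 \<or> x = max x 1" using \<phi>(2)[of "max x 1"] by simp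
    moreover have "\<phi> 1 = 0" "\<phi> (max x 1) = 0" using \<phi>(2)[of 1] \<phi>(2)[of "max x 1"] by auto
    ultimately have "\<phi> x \<le> v (max x 1) - v x" using v(4)[of x "max x 1"] by simp
    then show ?thesis using v(2)[of x] v(3)[of "max x 1"] by linarith
  qed
  have 1: "bv (\<lambda>y. \<phi> (inv0 y) * wt (inv0 y)) (7/8 * (M - v 0) + L * (Gt - G 0) + M / 32)"
    by (rule lasota_yorke_half[where v=v and \<delta>=\<delta>]) (use \<delta> L \<phi> \<phi>M v G Gt in auto)
  define N1 where "N1 = 7/8 * (M - (M - v (- 0))) + L * (- Gb - (- G (- 0))) + M / 32"
  have 2: "bv (\<lambda>y. \<phi> (- inv0 y) * wt (inv0 y)) N1"
    unfolding N1_def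
  proof (rule lasota_yorke_half[where \<delta>=\<delta> and \<phi>="\<lambda>x. \<phi> (- x)" and v="\<lambda>x. M - v (- x)" and G="\<lambda>x. - G (- x)" and Gt="- Gb"])
    show "mono (\<lambda>x. M - v (- x))" using v(1) by (auto simp: mono_def)
    show "\<bar>\<phi> (- y) - \<phi> (- x)\<bar> \<le> M - v (- y) - (M - v (- x))" if "x \<le> y" for x y
      using v(4)[of "-y" "-x"] that by linarith
    show "m * (y - x) \<le> - G (- y) - - G (- x)"
      if "x \<le> y" "0 \<le> m" "\<And>z. x \<le> z \<Longrightarrow> z \<le> y \<Longrightarrow> m \<le> \<phi> (- z)" for x y m
    proof -
      have "m * (- x - - y) \<le> G (- x) - G (- y)"
        using that(3)[of "- z" for z] that(1,2) by (intro G) (auto simp: minus_le_iff le_minus_iff)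
      then show ?thesis by simp
    qed
  qed (use \<delta> L \<phi> \<phi>M v Gb in auto)
  then obtain u where u: "mono u" "\<And>x. 0 \<le> u x" "\<And>x. u x \<le> N1"
    "\<And>x y. x \<le> y \<Longrightarrow> \<bar>\<phi> (- inv0 y) * wt (inv0 y) - \<phi> (- inv0 x) * wt (inv0 x)\<bar> \<le> u y - u x"
    unfolding bv_def by blast
  have 3: "bv (\<lambda>y. \<phi> (br True y) * wt (br True y)) N1"
    unfolding bv_def
  proof (intro exI[of _ "\<lambda>x. N1 - u (- x)"] conjI allI impI)
    show "mono (\<lambda>x. N1 - u (- x))" using u(1) by (auto simp: mono_def)
    show "\<bar>\<phi> (br True y) * wt (br True y) - \<phi> (br True x) * wt (br True x)\<bar> \<le> N1 - u (- y) - (N1 - u (- x))"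
      if "x \<le> y" for x y
      using u(4)[of "-y" "-x"] that by (simp add: br_def abs_minus_commute)
  qed (use u in auto)
  define N where "N b = (if b then N1 else 7/8 * (M - v 0) + L * (Gt - G 0) + M / 32)" for b
  show ?thesis
  proof (rule that[of N])
    have "N False + N True = 15/16 * M + L * (Gt - Gb)"
      by (simp add: N_def N1_def field_simps)
    then show "N False + N True \<le> 15/16 * M + L * (Gt - Gb)" by simp
  qed (use 1 3 in \<open>simp_all add: N_def br_def\<close>)
qed


subsection \<open>Words of inverse branches\<close>

text \<open>The head of the word acts first, so the forward orbit of \<open>pull w y\<close> meets
  the letters of w from last to first.\<close>

primrec pull :: "bool list \<Rightarrow> real \<Rightarrow> real" where
  "pull [] y = y"
| "pull (b # w) y = pull w (br b y)"

text \<open>The chain rule with cut-off weights: the derivative of \<open>pull w\<close> while the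
  images stay in the interval, and 0 as soon as one of them is 0.\<close>

primrec dpull :: "bool list \<Rightarrow> real \<Rightarrow> real" where
  "dpull [] y = 1"
| "dpull (b # w) y = dpull w (br b y) * wt (br b y)"

lemma pull_append: "pull (v @ w) y = pull w (pull v y)"
  by (induction v arbitrary: y) auto

lemma dpull_append: "dpull (v @ w) y = dpull w (pull v y) * dpull v y"
  by (induction v arbitrary: y) auto

lemma dpull_nonneg: "0 \<le> dpull w y"
  by (induction w arbitrary: y) (auto simp: wt_nonneg)

lemma dpull_le: "dpull w y \<le> (1 / \<sigma>) ^ length w"
proof (induction w arbitrary: y)
  case (Cons b w)
  have "dpull w (br b y) * wt (br b y) \<le> (1 / \<sigma>) ^ length w * (1 / \<sigma>)"
    using Cons wt_le wt_nonneg \<sigma>(2) by (intro mult_mono) auto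
  then show ?case by (simp add: mult.commute)
qed simp

lemma continuous_pull: "continuous_on S (pull w)"
proof -
  have "continuous_on UNIV (pull w)"
  proof (induction w)
    case (Cons b w)
    then show ?case using continuous_on_compose2[OF Cons continuous_br[of UNIV b]] by simp
  qed (auto simp: continuous_on_id)
  then show ?thesis using continuous_on_subset by blast
qed

lemma continuous_dpull: "continuous_on S (dpull w)"
proof -
  have "continuous_on UNIV (dpull w)"
  proof (induction w)
    case (Cons b w)
    have "continuous_on UNIV (\<lambda>y. dpull w (br b y))" "continuous_on UNIV (\<lambda>y. wt (br b y))"
      using continuous_on_compose2[OF Cons continuous_br[of UNIV b]]
        continuous_on_compose2[OF continuous_wt[of UNIV] continuous_br[of UNIV b]] by auto
    then show ?case by (simp add: continuous_on_mult)
  qed auto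
  then show ?thesis using continuous_on_subset by blast
qed

text \<open>A branch sends a point outside (-1/2,1/2) either to 0, where the weight vanishes, or
  outside again. So a positive weight together with a final image inside excludes any
  excursion.\<close>

lemma outside_pull: "\<bar>y\<bar> \<ge> 1/2 \<Longrightarrow> dpull w y = 0 \<or> \<bar>pull w y\<bar> \<ge> 1/2 \<or> w = []"
proof (induction w arbitrary: y)
  case (Cons b w)
  show ?case
  proof (cases "br b y = 0")
    case False
    then have "\<bar>br b y\<bar> \<ge> 1/2" using br_outside[OF Cons.prems, of b] by blast
    then show ?thesis using Cons.IH[of "br b y"] by auto
  qed simp
qed simp

lemma pull_inside: "0 < dpull w y \<Longrightarrow> \<bar>pull w y\<bar> < 1/2 \<Longrightarrow> \<bar>y\<bar> < 1/2"
  using outside_pull[of y w] by (cases "w = []") (auto simp: not_less[symmetric])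

lemma orbit_pull:
  assumes "0 < dpull w y" "\<bar>pull w y\<bar> < 1/2"
  shows "(f ^^ length w) (pull w y) = y" "\<And>s. s < length w \<Longrightarrow> (f ^^ s) (pull w y) \<noteq> 0"
proof -
  have "(f ^^ length w) (pull w y) = y \<and> (\<forall>s<length w. (f ^^ s) (pull w y) \<noteq> 0)"
    using assms
  proof (induction w arbitrary: y)
    case (Cons b w)
    define z where "z = br b y"
    have z: "0 < dpull w z" "z \<noteq> 0"
      using Cons.prems(1) dpull_nonneg[of w z] wt_nonneg[of z] by (auto simp: z_def zero_less_mult_iff)
    have IH: "(f ^^ length w) (pull w z) = z" "\<And>s. s < length w \<Longrightarrow> (f ^^ s) (pull w z) \<noteq> 0"
      using Cons.IH[of z] Cons.prems z by (auto simp: z_def)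
    have "\<bar>z\<bar> < 1/2" using pull_inside[OF z(1)] Cons.prems by (simp add: z_def)
    then have "f z = y" using f_br[of b y] z by (simp add: z_def)
    then show ?case using IH z by (auto simp: less_Suc_eq z_def)
  qed simp
  then show "(f ^^ length w) (pull w y) = y" "\<And>s. s < length w \<Longrightarrow> (f ^^ s) (pull w y) \<noteq> 0" by auto
qed

text \<open>The orbit of the common point determines the word: the sign of each iterate names its
  branch, and positive weights exclude the ambiguous value 0.\<close>

lemma pull_itinerary:
  assumes "length v = length w" "pull v x = pull w y" "\<bar>pull v x\<bar> < 1/2" "0 < dpull v x" "0 < dpull w y"
  shows "v = w"
  using assms
proof (induction v w arbitrary: x y rule: list_induct2)
  case (Cons b v c w)
  have pos: "0 < dpull v (br b x)" "0 < dpull w (br c y)" "br b x \<noteq> 0" "br c y \<noteq> 0"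
    using Cons.prems dpull_nonneg[of v "br b x"] wt_nonneg[of "br b x"]
      dpull_nonneg[of w "br c y"] wt_nonneg[of "br c y"] by (auto simp: zero_less_mult_iff)
  have vw: "v = w" using Cons.IH[of "br b x" "br c y"] Cons.prems pos by simp
  have "br b x = br c y"
    using orbit_pull(1)[OF pos(1)] orbit_pull(1)[OF pos(2)] Cons.prems Cons.hyps by simp
  then have "b = c" using br_side[OF pos(3)] br_side[OF pos(4)] by (cases b; cases c) auto
  then show ?case using vw by simp
qed simp

text \<open>
  The words are restricted to preimages in the fixed interval \<^term>\<open>{1/8..1/4::real}\<close>; clamping
  turns the inverse branch into a primitive of its restricted derivative that is defined everywhere.
\<close>

definition "den w y = (if pull w y \<in> {1/8..1/4} then dpull w y else 0)"

definition "prim w y = max (1/8) (min (1/4) (pull w y))"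

lemma den_Nil: "den [] y = (if y \<in> {1/8..1/4} then 1 else 0)"
  by (simp add: den_def)

lemma den_Cons: "den (b # w) y = den w (br b y) * wt (br b y)"
  by (simp add: den_def)

lemma prim_Cons: "prim (b # w) y = prim w (br b y)"
  by (simp add: prim_def)

lemma den_nonneg: "0 \<le> den w y"
  by (simp add: den_def dpull_nonneg)

lemma den_outside: "\<bar>y\<bar> \<ge> 1/2 \<Longrightarrow> den w y = 0"
  using outside_pull[of y w] by (auto simp: den_def)

lemma continuous_prim: "continuous_on S (prim w)"
  unfolding prim_def by (intro continuous_intros continuous_pull)

text \<open>The exceptional points are the corners of the clamp and of \<open>inv0\<close>,
  transported by \<open>F\<close>. As \<open>prim w\<close> is continuous, finitely many of them do
  not harm the fundamental theorem of calculus.\<close>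

lemma prim_deriv:
  "\<exists>S. finite S \<and> (\<forall>y. y \<notin> S \<longrightarrow> (prim w has_real_derivative den w y) (at y))"
proof (induction w)
  case Nil
  have "(prim [] has_real_derivative den [] y) (at y)" if y: "y \<notin> {1/8, 1/4}" for y
  proof -
    consider "y < 1/8" | "1/8 < y" "y < 1/4" | "1/4 < y" using y by fastforce
    then show ?thesis
    proof cases
      case 1
      have "((\<lambda>_. 1/8) has_real_derivative 0) (at y)" by simp
      then have "(prim [] has_real_derivative 0) (at y)"
        by (rule has_field_derivative_transform_within_open[of _ _ _ "{..<1/8}"]) (use 1 in \<open>auto simp: prim_def\<close>)
      then show ?thesis using 1 by (simp add: den_Nil)
    next
      case 2
      have "((\<lambda>x. x) has_real_derivative 1) (at y)" by simp
      then have "(prim [] has_real_derivative 1) (at y)"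
        by (rule has_field_derivative_transform_within_open[of _ _ _ "{1/8<..<1/4}"]) (use 2 in \<open>auto simp: prim_def\<close>)
      then show ?thesis using 2 by (simp add: den_Nil)
    next
      case 3
      have "((\<lambda>_. 1/4) has_real_derivative 0) (at y)" by simp
      then have "(prim [] has_real_derivative 0) (at y)"
        by (rule has_field_derivative_transform_within_open[of _ _ _ "{1/4<..}"]) (use 3 in \<open>auto simp: prim_def\<close>)
      then show ?thesis using 3 by (simp add: den_Nil)
    qed
  qed
  then show ?case by (intro exI[of _ "{1/8, 1/4}"]) auto
next
  case (Cons b w)
  then obtain S where S: "finite S" "\<And>y. y \<notin> S \<Longrightarrow> (prim w has_real_derivative den w y) (at y)" by blast
  define S' where "S' = insert (- sg b / 2) ((\<lambda>x. sg b * F (sg b * x)) ` S)"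
  have "(prim (b # w) has_real_derivative den (b # w) y) (at y)" if y: "y \<notin> S'" for y
  proof (cases "sg b * y < -1/2")
    case True
    have "((\<lambda>_. prim w 0) has_real_derivative 0) (at y)" by simp
    then have "(prim (b # w) has_real_derivative 0) (at y)"
      by (rule has_field_derivative_transform_within_open[of _ _ _ "{y. sg b * y < -1/2}"])
        (use True in \<open>auto simp: prim_Cons br_def intro!: open_Collect_less continuous_intros\<close>)
    then show ?thesis using True by (simp add: den_Cons br_def)
  next
    case False
    moreover have "sg b * y \<noteq> -1/2" using y by (auto simp: S'_def sg_def split: if_splits)
    ultimately have y1: "-1/2 < sg b * y" by simp
    have brS: "br b y \<notin> S"
    proof
      assume "br b y \<in> S"
      moreover have "sg b * F (sg b * br b y) = y" using F_inv0[of "sg b * y"] y1 by (simp add: br_def)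
      ultimately show False using y by (force simp: S'_def)
    qed
    show ?thesis
    proof (cases "\<bar>br b y\<bar> \<le> 1/2")
      case True
      show ?thesis unfolding prim_Cons[abs_def] den_Cons
        by (rule DERIV_chain2[where f="prim w" and g="br b"]) (use S(2)[OF brS] br_deriv[OF y1 True] in auto)
    next
      case False
      \<comment> \<open>Beyond the cut-off the weight is no longer the derivative of
        \<open>br b\<close>, but the outer factor \<open>den w\<close> is 0 there, so both products
        vanish.\<close>
      have D: "(br b has_real_derivative sg b * (inv0 (sg b * y) powr (1 - \<alpha>) / (\<alpha> * \<theta>) * sg b)) (at y)"
        unfolding br_def[abs_def]
        by (intro DERIV_cmult DERIV_chain2[where f=inv0 and g="\<lambda>y. sg b * y", OF inv0_deriv[OF y1]])
          (auto intro!: derivative_eq_intros)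
      have "(prim (b # w) has_real_derivative den w (br b y) * (sg b * (inv0 (sg b * y) powr (1 - \<alpha>) / (\<alpha> * \<theta>) * sg b))) (at y)"
        unfolding prim_Cons[abs_def] by (rule DERIV_chain2[where f="prim w" and g="br b", OF S(2)[OF brS] D])
      moreover have "den w (br b y) = 0" using False by (intro den_outside) simp
      ultimately show ?thesis by (simp add: den_Cons)
    qed
  qed
  moreover have "finite S'" using S by (simp add: S'_def)
  ultimately show ?case by blast
qed

lemma den_has_integral:
  assumes "x \<le> y"
  shows "(den w has_integral prim w y - prim w x) {x..y}"
proof -
  obtain S where "finite S" "\<And>y. y \<notin> S \<Longrightarrow> (prim w has_real_derivative den w y) (at y)"
    using prim_deriv by blast
  then show ?thesis
    using assms by (intro fundamental_theorem_of_calculus_strong[of S])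
      (auto simp: continuous_prim has_real_derivative_iff_has_vector_derivative)
qed

lemma prim_diff_ge:
  assumes "x \<le> y" "\<And>z. x \<le> z \<Longrightarrow> z \<le> y \<Longrightarrow> m \<le> den w z"
  shows "m * (y - x) \<le> prim w y - prim w x"
  using has_integral_le[OF has_integral_const_real[of m x y] den_has_integral[OF assms(1), of w]] assms
  by (simp add: mult.commute)

lemma prim_diff_le:
  assumes "x \<le> y" "\<And>z. x \<le> z \<Longrightarrow> z \<le> y \<Longrightarrow> den w z \<le> m"
  shows "prim w y - prim w x \<le> m * (y - x)"
  using has_integral_le[OF den_has_integral[OF assms(1), of w] has_integral_const_real[of m x y]] assms
  by (simp add: mult.commute)

lemma prim_mono: "x \<le> y \<Longrightarrow> prim w x \<le> prim w y"
  using prim_diff_ge[of x y 0 w] den_nonneg by simp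

lemma prim_outside:
  "1/2 \<le> y \<Longrightarrow> prim w y = prim w (1/2)" "y \<le> -1/2 \<Longrightarrow> prim w y = prim w (-1/2)"
proof -
  have "(1/2 \<le> y \<longrightarrow> prim w y = prim w (1/2)) \<and> (y \<le> -1/2 \<longrightarrow> prim w y = prim w (-1/2))" for y
  proof (induction w arbitrary: y)
    case Nil
    then show ?case by (auto simp: prim_def)
  next
    case (Cons b w)
    have I: "prim w (inv0 z) = prim w (1/2)" "prim w (- inv0 z) = prim w (-1/2)" if "1/2 \<le> z" for z
      using Cons[of "inv0 z"] Cons[of "- inv0 z"] inv0_half[OF that] by auto
    show ?case
      using I[of y] I[of "1/2"] I[of "- y"] by (cases b) (auto simp: prim_Cons br_def)
  qed
  then show "1/2 \<le> y \<Longrightarrow> prim w y = prim w (1/2)" "y \<le> -1/2 \<Longrightarrow> prim w y = prim w (-1/2)" by blast+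
qed

section \<open>Conservation of mass and the uniform bound on variation\<close>

definition "mass w = prim w (1/2) - prim w (-1/2)"

lemma mass_Nil: "mass [] = 1/8"
  by (simp add: mass_def prim_def)

text \<open>The two branches send [-1/2,1/2] onto intervals that meet at 0 and together contain
  [-1/2,1/2], beyond which \<open>prim w\<close> is constant. This is how the transfer operator
  preserves integrals.\<close>

lemma mass_split: "mass (False # w) + mass (True # w) = mass w"
  using prim_outside(1)[of "inv0 (1/2)" w] prim_outside(2)[of "- inv0 (1/2)" w] inv0_half[of "1/2"]
  by (simp add: mass_def prim_Cons br_def)

lemma finite_words: "finite {w :: bool list. length w = n}"
  using finite_lists_length_eq[of "UNIV :: bool set" n] by simp

lemma sum_words_Suc:
  fixes h :: "bool list \<Rightarrow> real"
  shows "(\<Sum>w | length w = Suc n. h w) = (\<Sum>w | length w = n. h (False # w) + h (True # w))"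
proof -
  let ?W = "{w :: bool list. length w = n}"
  have "{w :: bool list. length w = Suc n} = Cons False ` ?W \<union> Cons True ` ?W"
    by (auto simp: length_Suc_conv image_iff)
  then have "(\<Sum>w | length w = Suc n. h w) = (\<Sum>w\<in>Cons False ` ?W. h w) + (\<Sum>w\<in>Cons True ` ?W. h w)"
    using finite_words by (simp only:, intro sum.union_disjoint) auto
  also have "\<dots> = (\<Sum>w\<in>?W. h (False # w)) + (\<Sum>w\<in>?W. h (True # w))"
    by (simp add: sum.reindex)
  finally show ?thesis by (simp add: sum.distrib)
qed

lemma sum_mass: "(\<Sum>w | length w = n. mass w) = 1/8"
  by (induction n) (simp_all add: sum_words_Suc mass_split mass_Nil)

lemma bv_den_Nil: "bv (den []) 2"
  unfolding bv_def
  by (intro exI[of _ "\<lambda>x. if x < 1/8 then 0 else if x \<le> 1/4 then 1 else 2"])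
    (auto simp: den_Nil mono_def)

lemma total_variation_bounded:
  obtains W where "\<And>n. \<exists>M. (\<forall>w. length w = n \<longrightarrow> bv (den w) (M w)) \<and> (\<Sum>w | length w = n. M w) \<le> W"
proof -
  have "\<exists>\<delta>>0. wt \<delta> \<le> 1/32"
  proof -
    have "isCont wt 0" using continuous_wt[of UNIV] by (simp add: continuous_on_eq_continuous_at)
    then have "\<forall>\<^sub>F x in at_right 0. wt x < 1/32"
      unfolding isCont_def using filterlim_mono[OF _ order_refl at_le[of "{0<..}" UNIV 0]]
      by (intro order_tendstoD(2)[of wt "wt 0"]) auto
    then have "\<forall>\<^sub>F x in at_right 0. wt x < 1/32 \<and> (0::real) < x"
      by (intro eventually_conj) (auto simp: eventually_at_right_less)
    then show ?thesis
      using eventually_happens'[OF trivial_limit_at_right_real] by (metis (no_types, lifting) less_imp_le)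
  qed
  then obtain \<delta> where \<delta>: "0 < \<delta>" "wt \<delta> \<le> 1/32" by blast
  obtain L where L: "0 < L" "\<And>x y. 0 \<le> x \<Longrightarrow> x \<le> y \<Longrightarrow> wt (max y \<delta>) - wt (max x \<delta>) \<le> L * (y - x)"
    using wt_lipschitz[OF \<delta>(1)] by metis
  have step: "\<exists>N. bv (den (False # w)) (N False) \<and> bv (den (True # w)) (N True)
      \<and> N False + N True \<le> 15/16 * M + L * mass w" if w: "bv (den w) M" for w M
  proof -
    have bounds: "prim w (-1/2) \<le> prim w x" "prim w x \<le> prim w (1/2)" for x
      using prim_outside[of x w] prim_mono[of "-1/2" x w] prim_mono[of x "1/2" w] by force+
    obtain N where "bv (\<lambda>y. den w (br False y) * wt (br False y)) (N False)"
      "bv (\<lambda>y. den w (br True y) * wt (br True y)) (N True)"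
      "N False + N True \<le> 15/16 * M + L * (prim w (1/2) - prim w (-1/2))"
      by (rule lasota_yorke[OF \<delta> L, where \<phi>="den w" and M=M and G="prim w"])
        (use w den_nonneg den_outside prim_diff_ge bounds in auto)
    then show ?thesis unfolding den_Cons[abs_def] mass_def by blast
  qed
  \<comment> \<open>2 is the variation for the empty word, and 2 L is the fixed point of X = 15/16 X
    + L/8.\<close>
  define W where "W = max 2 (2 * L)"
  have "\<exists>M. (\<forall>w. length w = n \<longrightarrow> bv (den w) (M w)) \<and> (\<Sum>w | length w = n. M w) \<le> W" for n
  proof (induction n)
    case 0
    show ?case by (intro exI[of _ "\<lambda>_. 2"]) (auto simp: bv_den_Nil W_def)
  next
    case (Suc n)
    then obtain M where M: "\<And>w. length w = n \<Longrightarrow> bv (den w) (M w)" "(\<Sum>w | length w = n. M w) \<le> W" by blast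
    have "\<forall>w. \<exists>N. length w = n \<longrightarrow> bv (den (False # w)) (N False) \<and> bv (den (True # w)) (N True)
      \<and> N False + N True \<le> 15/16 * M w + L * mass w"
      using step M(1) by blast
    then obtain N where N: "\<And>w. length w = n \<Longrightarrow> bv (den (False # w)) (N w False)"
      "\<And>w. length w = n \<Longrightarrow> bv (den (True # w)) (N w True)"
      "\<And>w. length w = n \<Longrightarrow> N w False + N w True \<le> 15/16 * M w + L * mass w"
      by metis
    define M' where "M' u = (case u of [] \<Rightarrow> 0 | b # w \<Rightarrow> N w b)" for u
    have "bv (den u) (M' u)" if u: "length u = Suc n" for u
    proof -
      obtain b w where "u = b # w" "length w = n" using u by (cases u) auto
      then show ?thesis using N(1,2) by (cases b) (auto simp: M'_def)
    qed
    moreover have "(\<Sum>u | length u = Suc n. M' u) \<le> W"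
    proof -
      have "(\<Sum>u | length u = Suc n. M' u) = (\<Sum>w | length w = n. N w False + N w True)"
        by (simp add: sum_words_Suc M'_def)
      also have "\<dots> \<le> (\<Sum>w | length w = n. 15/16 * M w + L * mass w)" by (intro sum_mono) (use N(3) in auto)
      also have "\<dots> = 15/16 * (\<Sum>w | length w = n. M w) + L * (1/8)"
        unfolding sum_mass[of n, symmetric] by (simp only: sum.distrib sum_distrib_left)
      also have "\<dots> \<le> W" using M(2) by (simp add: W_def)
      finally show ?thesis .
    qed
    ultimately show ?case by blast
  qed
  then show ?thesis using that by blast
qed

definition cell :: "nat \<Rightarrow> nat \<Rightarrow> real set" where
  "cell N i = {-1/2 + real i / real N..-1/2 + real (Suc i) / real N}"

text \<open>
  Summed over all words, the oscillation of the densities over the cells of a fine partition is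
  dominated by the total mass, so for each length some cell carries full branches of definite mass.
\<close>

lemma cell_with_mass:
  obtains N where "0 < N"
    "\<And>n. \<exists>i<N. \<exists>m. (\<forall>w. length w = n \<longrightarrow> (\<forall>y\<in>cell N i. m w \<le> den w y)) \<and> 1/16 \<le> (\<Sum>w | length w = n. m w)"
proof -
  obtain W where W: "\<And>n. \<exists>M. (\<forall>w. length w = n \<longrightarrow> bv (den w) (M w)) \<and> (\<Sum>w | length w = n. M w) \<le> W"
    using total_variation_bounded by blast
  \<comment> \<open>With this N the total over cells and words is at least N/8 - W \<ge> N/16, that
    is 1/16 per cell.\<close>
  obtain k where "16 * W \<le> real k" using real_arch_simple by blast
  then obtain N where N: "N > 0" "16 * W \<le> real N" by (intro that[of "Suc k"]) auto
  show ?thesis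
  proof (rule that[OF N(1)])
    fix n
    obtain M where M: "\<And>w. length w = n \<Longrightarrow> bv (den w) (M w)" "(\<Sum>w | length w = n. M w) \<le> W"
      using W by blast
    have "\<forall>w. \<exists>v. length w = n \<longrightarrow> mono v \<and> (\<forall>x. 0 \<le> v x \<and> v x \<le> M w) \<and> (\<forall>x y. x \<le> y \<longrightarrow> \<bar>den w y - den w x\<bar> \<le> v y - v x)"
      using M(1) unfolding bv_def by blast
    then obtain v where v: "\<And>w. length w = n \<Longrightarrow> mono (v w)" "\<And>w x. length w = n \<Longrightarrow> 0 \<le> v w x"
      "\<And>w x. length w = n \<Longrightarrow> v w x \<le> M w"
      "\<And>w x y. length w = n \<Longrightarrow> x \<le> y \<Longrightarrow> \<bar>den w y - den w x\<bar> \<le> v w y - v w x"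
      by metis
    define x where "x i = -1/2 + real i / real N" for i
    have xstep: "x (Suc i) - x i = 1 / real N" for i by (simp add: x_def diff_divide_distrib[symmetric])
    \<comment> \<open>The mean of the density over the cell minus a bound for its oscillation there;
      it may be negative.\<close>
    define m where "m w i = real N * (prim w (x (Suc i)) - prim w (x i)) - (v w (x (Suc i)) - v w (x i))" for w i
    have lower: "m w i \<le> den w y" if w: "length w = n" and y: "y \<in> cell N i" for w i y
    proof -
      have xy: "x i \<le> y" "y \<le> x (Suc i)" using y by (auto simp: cell_def x_def)
      have "den w z \<le> den w y + (v w (x (Suc i)) - v w (x i))" if z: "x i \<le> z" "z \<le> x (Suc i)" for z
      proof -
        have "v w (x i) \<le> v w z" "v w z \<le> v w (x (Suc i))" "v w (x i) \<le> v w y" "v w y \<le> v w (x (Suc i))"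
          using v(1)[OF w] z xy by (auto simp: mono_def)
        moreover have "den w z - den w y \<le> \<bar>v w z - v w y\<bar>"
          using v(4)[OF w, of y z] v(4)[OF w, of z y] by (cases "y \<le> z") auto
        ultimately show ?thesis by linarith
      qed
      then have "prim w (x (Suc i)) - prim w (x i) \<le> (den w y + (v w (x (Suc i)) - v w (x i))) * (x (Suc i) - x i)"
        using xy by (intro prim_diff_le) auto
      then show ?thesis unfolding xstep using N(1) by (simp add: m_def field_simps)
    qed
    have tele: "real N * mass w - M w \<le> (\<Sum>i<N. m w i)" if w: "length w = n" for w
    proof -
      have "(\<Sum>i<N. m w i) = real N * (\<Sum>i<N. prim w (x (Suc i)) - prim w (x i)) - (\<Sum>i<N. v w (x (Suc i)) - v w (x i))"
        by (simp only: m_def sum_subtractf[of "\<lambda>i. real N * (prim w (x (Suc i)) - prim w (x i))"] sum_distrib_left)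
      also have "\<dots> = real N * (prim w (x N) - prim w (x 0)) - (v w (x N) - v w (x 0))"
        by (simp only: sum_lessThan_telescope[of "\<lambda>i. prim w (x i)"] sum_lessThan_telescope[of "\<lambda>i. v w (x i)"])
      finally have "(\<Sum>i<N. m w i) = real N * mass w - (v w (1/2) - v w (-1/2))"
        using N(1) by (simp add: mass_def x_def)
      then show ?thesis using v(2)[OF w, of "-1/2"] v(3)[OF w, of "1/2"] by simp
    qed
    have "\<exists>i<N. 1/16 \<le> (\<Sum>w | length w = n. m w i)"
    proof (rule ccontr)
      assume "\<not> (\<exists>i<N. 1/16 \<le> (\<Sum>w | length w = n. m w i))"
      then have "(\<Sum>i<N. \<Sum>w | length w = n. m w i) < (\<Sum>i<N. 1/16)"
        using N(1) by (intro sum_strict_mono) (auto simp: not_le)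
      moreover have "(\<Sum>i<N. \<Sum>w | length w = n. m w i) = (\<Sum>w | length w = n. \<Sum>i<N. m w i)" by (rule sum.swap)
      moreover have "(\<Sum>w | length w = n. real N * mass w - M w) \<le> (\<Sum>w | length w = n. \<Sum>i<N. m w i)"
        by (intro sum_mono) (use tele in auto)
      moreover have "(\<Sum>w | length w = n. real N * mass w - M w) = real N * (1/8) - (\<Sum>w | length w = n. M w)"
        unfolding sum_mass[of n, symmetric] by (simp only: sum_subtractf sum_distrib_left)
      ultimately have "real N * (1/8) - (\<Sum>w | length w = n. M w) < real N / 16" by simp
      then show False using M(2) N(2) by simp
    qed
    then obtain i where "i < N" "1/16 \<le> (\<Sum>w | length w = n. m w i)" by blast
    then show "\<exists>i<N. \<exists>m. (\<forall>w. length w = n \<longrightarrow> (\<forall>y\<in>cell N i. m w \<le> den w y)) \<and> 1/16 \<le> (\<Sum>w | length w = n. m w)"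
      using lower by (intro exI[of _ i] conjI exI[of _ "\<lambda>w. m w i"]) auto
  qed
qed


subsection \<open>Transitivity\<close>

text \<open>Transitivity read backwards: a single word carries all of Y into T, so for T inside
  (-1/2,1/2) an iterate of \<open>f\<close> maps part of T bijectively onto Y.\<close>

definition covers :: "real set \<Rightarrow> real set \<Rightarrow> bool" where
  "covers T Y \<longleftrightarrow> (\<exists>t. \<forall>y\<in>Y. pull t y \<in> T \<and> 0 < dpull t y)"

text \<open>Intervals in the coordinate \<open>sg b * x\<close>. Endpoints may be negative, so an
  image that crosses 0 keeps this form.\<close>

definition ivl :: "bool \<Rightarrow> real \<Rightarrow> real \<Rightarrow> real set" where
  "ivl b u v = {x. u < sg b * x \<and> sg b * x < v}"

lemma covers_trans: "covers T Y \<Longrightarrow> covers Y Z \<Longrightarrow> covers T Z"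
proof -
  assume "covers T Y" "covers Y Z"
  then obtain t s where ts: "\<And>y. y \<in> Y \<Longrightarrow> pull t y \<in> T \<and> 0 < dpull t y" "\<And>z. z \<in> Z \<Longrightarrow> pull s z \<in> Y \<and> 0 < dpull s z"
    unfolding covers_def by blast
  then have "\<forall>z\<in>Z. pull (s @ t) z \<in> T \<and> 0 < dpull (s @ t) z"
    by (simp add: pull_append dpull_append)
  then show ?thesis unfolding covers_def by blast
qed

lemma covers_subset: "Y \<subseteq> T \<Longrightarrow> covers T Y"
  unfolding covers_def by (intro exI[of _ "[]"]) auto

lemma covers_trans_subset: "covers T Y \<Longrightarrow> Z \<subseteq> Y \<Longrightarrow> covers Z W \<Longrightarrow> covers T W"
  by (rule covers_trans, assumption, rule covers_trans[OF covers_subset])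

lemma ivl_Not: "ivl b u v = ivl (\<not> b) (- v) (- u)"
  by (cases b) (auto simp: ivl_def)

lemma ivl_mono: "u' \<le> u \<Longrightarrow> v \<le> v' \<Longrightarrow> ivl b u v \<subseteq> ivl b u' v'"
  by (auto simp: ivl_def)

lemma covers_image:
  assumes "0 \<le> u" "u < v"
  shows "covers (ivl b u v) (ivl b (F u) (F v))"
  unfolding covers_def
proof (intro exI[of _ "[b]"] ballI conjI)
  fix y assume "y \<in> ivl b (F u) (F v)"
  then have y: "F u < sg b * y" "sg b * y < F v" by (auto simp: ivl_def)
  have Fu: "-1/2 \<le> F u" using F_mono[of 0 u] assms by simp
  have "u < inv0 (sg b * y)" using inv0_strict_mono[OF Fu y(1)] inv0_F assms by simp
  moreover have "inv0 (sg b * y) < v" using inv0_strict_mono[of "sg b * y" "F v"] y Fu inv0_F assms by simp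
  ultimately show "pull [b] y \<in> ivl b u v" "0 < dpull [b] y"
    using assms by (auto simp: ivl_def br_def intro!: wt_pos)
qed

lemma F_expanding:
  assumes "0 \<le> u" "u < v" "v \<le> 1/2"
  shows "\<sigma> * (v - u) \<le> F v - F u"
proof -
  have der: "(F has_real_derivative \<alpha> * \<theta> * z powr (\<alpha> - 1)) (at z)" if "u < z" for z
    unfolding F_def using that assms by (auto intro!: derivative_eq_intros)
  have "continuous_on {u..v} F"
    unfolding F_def using assms \<alpha> by (intro continuous_intros continuous_on_powr') auto
  then obtain l z where z: "u < z" "z < v" "(F has_real_derivative l) (at z)" "F v - F u = (v - u) * l"
    using MVT[of u v F] assms der by (metis real_differentiable_def)
  have "l = \<alpha> * \<theta> * z powr (\<alpha> - 1)" using DERIV_unique[OF z(3) der[OF z(1)]] .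
  moreover have "(1/2) powr (\<alpha> - 1) \<le> z powr (\<alpha> - 1)" using z assms \<alpha> by (intro powr_mono2') auto
  ultimately have "\<sigma> \<le> l" using \<alpha> \<theta>_pos by (simp add: \<sigma>_def)
  then show ?thesis using assms by (simp add: z(4) mult.commute mult_left_mono)
qed

text \<open>A half covers itself by the empty word. Its image reaches from the far endpoint of the
  opposite half across 0, because F(1/2) > 0, and so contains that half.\<close>

lemma half_covers_half: "covers (ivl b 0 (1/2)) (ivl c 0 (1/2))"
proof (cases "c = b")
  case True
  then show ?thesis by (simp add: covers_subset)
next
  case False
  have "covers (ivl b 0 (1/2)) (ivl b (-1/2) (F (1/2)))" using covers_image[of 0 "1/2" b] by simp
  moreover have "ivl c 0 (1/2) \<subseteq> ivl b (-1/2) (F (1/2))"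
    using ivl_mono[of "-1/2" "-1/2" 0 "F (1/2)" b] F_half ivl_Not[of c 0 "1/2"] False by (cases b) auto
  ultimately show ?thesis by (rule covers_trans[OF _ covers_subset])
qed

text \<open>
  An interval grows by the factor \<^term>\<open>\<sigma>\<close> unless its image contains the discontinuity.  In that case
  the larger half of the image is kept; its own image has length at least \<open>\<sigma>\<^sup>2 / 2 > 1\<close> times the original one
  or reaches across the discontinuity again, and then covers a whole side.
\<close>

lemma interval_covers_half_aux:
  assumes "0 \<le> u" "u < v" "v \<le> 1/2" "1 \<le> (v - u) * (min \<sigma> (\<sigma>\<^sup>2 / 2)) ^ n"
  shows "covers (ivl b u v) (ivl c 0 (1/2))"
  using assms
proof (induction n arbitrary: u v b c)
  case 0
  \<comment> \<open>Here the interval would have length at least 1 inside a half of length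
    1/2.\<close>
  then show ?case by simp
next
  case (Suc n)
  define \<rho> where "\<rho> = min \<sigma> (\<sigma>\<^sup>2 / 2)"
  have \<rho>: "1 < \<rho>" using \<sigma> by (simp add: \<rho>_def)
  have IH: "covers (ivl b' u' v') (ivl c 0 (1/2))"
    if "0 \<le> u'" "v' \<le> 1/2" "\<rho> * (v - u) \<le> v' - u'" for b' u' v'
  proof -
    have "0 < \<rho> * (v - u)" using \<rho> Suc.prems by simp
    then have "u' < v'" using that by linarith
    moreover have "1 \<le> (v' - u') * \<rho> ^ n"
    proof -
      have "1 \<le> \<rho> * (v - u) * \<rho> ^ n" using Suc.prems(4) by (simp add: \<rho>_def mult.assoc mult.left_commute)
      also have "\<dots> \<le> (v' - u') * \<rho> ^ n" using that \<rho> by (intro mult_right_mono) auto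
      finally show ?thesis .
    qed
    ultimately show ?thesis using Suc.IH that unfolding \<rho>_def by blast
  qed
  have step: "covers (ivl b u v) (ivl b (F u) (F v))" using covers_image Suc.prems by blast
  have exp: "\<sigma> * (v - u) \<le> F v - F u" using F_expanding Suc.prems by blast
  have rv: "\<rho> * (v - u) \<le> \<sigma> * (v - u)" using Suc.prems by (intro mult_right_mono) (auto simp: \<rho>_def)
  have rv2: "\<rho> * (v - u) \<le> \<sigma> * (\<sigma> * (v - u) / 2)"
  proof -
    have "\<rho> * (v - u) \<le> \<sigma>\<^sup>2 / 2 * (v - u)" using Suc.prems by (intro mult_right_mono) (auto simp: \<rho>_def)
    then show ?thesis by (simp add: power2_eq_square)
  qed
  have Fv: "F v \<le> F (1/2)" "-1/2 \<le> F u" using F_mono[of v "1/2"] F_mono[of 0 u] Suc.prems by auto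
  have half: "covers (ivl b' 0 l) (ivl c 0 (1/2))" if l: "\<sigma> * (v - u) / 2 \<le> l" "l \<le> 1/2" for b' l
  proof -
    have "0 < \<sigma> * (v - u) / 2" using \<sigma> Suc.prems by simp
    then have l0: "0 < l" using l by linarith
    have c1: "covers (ivl b' 0 l) (ivl b' (-1/2) (F l))" using covers_image[of 0 l b'] l0 by simp
    show ?thesis
    proof (cases "0 \<le> F l")
      case True
      have "ivl (\<not> b') 0 (1/2) \<subseteq> ivl b' (-1/2) (F l)"
        using ivl_mono[of "-1/2" "-1/2" 0 "F l" b'] True ivl_Not[of "\<not> b'" 0 "1/2"] by simp
      then show ?thesis by (rule covers_trans_subset[OF c1 _ half_covers_half])
    next
      case False
      have "\<sigma> * l \<le> F l + 1/2" using F_expanding[of 0 l] l0 l by simp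
      moreover have "\<sigma> * (\<sigma> * (v - u) / 2) \<le> \<sigma> * l" using l \<sigma> by (intro mult_left_mono) auto
      ultimately have "covers (ivl (\<not> b') (- F l) (1/2)) (ivl c 0 (1/2))"
        using rv2 False by (intro IH) auto
      then have "covers (ivl b' (-1/2) (F l)) (ivl c 0 (1/2))"
        using ivl_Not[of b' "-1/2" "F l"] by simp
      then show ?thesis by (rule covers_trans[OF c1])
    qed
  qed
  consider "0 \<le> F u" | "F v \<le> 0" | "F u < 0" "0 < F v" by linarith
  then show ?case
  proof cases
    case 1
    then have "covers (ivl b (F u) (F v)) (ivl c 0 (1/2))"
      using Fv F_half exp rv by (intro IH) auto
    then show ?thesis using step covers_trans by blast
  next
    case 2
    then have "covers (ivl (\<not> b) (- F v) (- F u)) (ivl c 0 (1/2))"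
      using Fv exp rv by (intro IH) auto
    then have "covers (ivl b (F u) (F v)) (ivl c 0 (1/2))"
      using ivl_Not[of b "F u" "F v"] by simp
    then show ?thesis by (rule covers_trans[OF step])
  next
    case 3
    consider "\<sigma> * (v - u) / 2 \<le> F v" | "\<sigma> * (v - u) / 2 \<le> - F u" using exp by linarith
    then show ?thesis
    proof cases
      case 1
      have "covers (ivl b 0 (F v)) (ivl c 0 (1/2))" using Fv F_half 1 by (intro half) auto
      moreover have "ivl b 0 (F v) \<subseteq> ivl b (F u) (F v)" using 3 by (intro ivl_mono) auto
      ultimately show ?thesis by (intro covers_trans_subset[OF step])
    next
      case 2
      have "covers (ivl (\<not> b) 0 (- F u)) (ivl c 0 (1/2))" using Fv 2 by (intro half) auto
      moreover have "ivl (\<not> b) 0 (- F u) \<subseteq> ivl b (F u) (F v)"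
        using 3 ivl_mono[of "F u" "F u" 0 "F v" b] ivl_Not[of "\<not> b" 0 "- F u"] by simp
      ultimately show ?thesis by (intro covers_trans_subset[OF step])
    qed
  qed
qed

lemma interval_covers_half:
  assumes "0 \<le> u" "u < v" "v \<le> 1/2"
  shows "covers (ivl b u v) (ivl c 0 (1/2))"
proof -
  have "1 < min \<sigma> (\<sigma>\<^sup>2 / 2)" using \<sigma> by simp
  then obtain n where "1 / (v - u) < (min \<sigma> (\<sigma>\<^sup>2 / 2)) ^ n" using real_arch_pow by blast
  then show ?thesis using assms
    by (intro interval_covers_half_aux[of _ _ n]) (auto simp: field_simps)
qed

lemma cell_covers:
  assumes "i < N"
  obtains t d where "0 < d" "\<And>y. y \<in> {1/8..1/4} \<Longrightarrow> pull t y \<in> cell N i \<and> d \<le> dpull t y"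
proof -
  define u where "u = -1/2 + real i / real N"
  define v where "v = -1/2 + real (Suc i) / real N"
  have iN: "real (Suc i) / real N \<le> 1" "0 \<le> real i / real N" "real i / real N < real (Suc i) / real N"
    using assms by (simp_all add: divide_simps)
  have uv: "-1/2 \<le> u" "u < v" "v \<le> 1/2" using iN unfolding u_def v_def by linarith+
  \<comment> \<open>A cell may straddle 0; its right part is kept whenever it is
    nondegenerate.\<close>
  have "\<exists>b u' v'. 0 \<le> u' \<and> u' < v' \<and> v' \<le> 1/2 \<and> ivl b u' v' \<subseteq> cell N i"
  proof (cases "0 < v")
    case True
    then show ?thesis using uv
      by (intro exI[of _ False] exI[of _ "max 0 u"] exI[of _ v]) (auto simp: ivl_def cell_def u_def v_def)
  next
    case False
    then show ?thesis using uv
      by (intro exI[of _ True] exI[of _ "- v"] exI[of _ "- u"]) (auto simp: ivl_def cell_def u_def v_def)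
  qed
  then obtain b u' v' where *: "0 \<le> u'" "u' < v'" "v' \<le> 1/2" "ivl b u' v' \<subseteq> cell N i" by blast
  have "covers (cell N i) (ivl False 0 (1/2))"
    by (rule covers_trans[OF covers_subset[OF *(4)] interval_covers_half[OF *(1-3)]])
  moreover have "{1/8..1/4} \<subseteq> ivl False 0 (1/2)" by (auto simp: ivl_def)
  ultimately obtain t where t: "\<And>y. y \<in> {1/8..1/4} \<Longrightarrow> pull t y \<in> cell N i \<and> 0 < dpull t y"
    unfolding covers_def by blast
  obtain z where z: "z \<in> {1/8..1/4}" "\<And>y. y \<in> {1/8..1/4} \<Longrightarrow> dpull t z \<le> dpull t y"
    using continuous_attains_inf[of "{1/8..1/4}" "dpull t"] continuous_dpull by auto
  show ?thesis by (rule that[of "dpull t z" t]) (use z t in auto)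
qed

subsection \<open>Full branches\<close>

definition full :: "nat \<Rightarrow> bool list set" where
  "full n = {w. length w = n \<and> (\<forall>y\<in>{1/8..1/4}. pull w y \<in> {1/8..1/4} \<and> 0 < dpull w y)}"

definition mind :: "bool list \<Rightarrow> real" where
  "mind w = (INF y\<in>{1/8..1/4}. dpull w y)"

lemma finite_full: "finite (full n)"
  by (rule finite_subset[OF _ finite_words[of n]]) (auto simp: full_def)

lemma mind_le: "y \<in> {1/8..1/4} \<Longrightarrow> mind w \<le> dpull w y"
  unfolding mind_def by (intro cINF_lower bdd_belowI2[of _ 0]) (auto simp: dpull_nonneg)

lemma mind_ge: "(\<And>y. y \<in> {1/8..1/4} \<Longrightarrow> m \<le> dpull w y) \<Longrightarrow> m \<le> mind w"
  unfolding mind_def by (intro cINF_greatest) auto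

lemma mind_pos:
  assumes "w \<in> full n"
  shows "0 < mind w"
proof -
  obtain z where z: "z \<in> {1/8..1/4}" "\<And>y. y \<in> {1/8..1/4} \<Longrightarrow> dpull w z \<le> dpull w y"
    using continuous_attains_inf[of "{1/8..1/4}" "dpull w"] continuous_dpull by auto
  have "0 < dpull w z" using assms z(1) by (auto simp: full_def)
  also have "\<dots> \<le> mind w" using z(2) by (rule mind_ge)
  finally show ?thesis .
qed

lemma mind_le_power: "mind w \<le> (1 / \<sigma>) ^ length w"
  using mind_le[of "1/8" w] dpull_le[of w "1/8"] by simp

lemma full_append: "v \<in> full m \<Longrightarrow> w \<in> full n \<Longrightarrow> v @ w \<in> full (m + n)"
  by (auto simp: full_def pull_append dpull_append)

text \<open>A transition word pulls A into the selected cell, and the branches with positive bound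
  pull that cell back into A. The length of the transition word depends on the cell, so the final
  length is only known to be at least n.\<close>

lemma full_mass:
  obtains \<eta> where "0 < \<eta>" "\<And>n. \<exists>m\<ge>n. \<eta> \<le> (\<Sum>w\<in>full m. mind w)"
proof -
  obtain N where N: "0 < N"
    "\<And>n. \<exists>i<N. \<exists>m. (\<forall>w. length w = n \<longrightarrow> (\<forall>y\<in>cell N i. m w \<le> den w y)) \<and> 1/16 \<le> (\<Sum>w | length w = n. m w)"
    using cell_with_mass by blast
  have "\<forall>i. \<exists>t d. i < N \<longrightarrow> 0 < d \<and> (\<forall>y\<in>{1/8..1/4}. pull t y \<in> cell N i \<and> d \<le> dpull t y)"
    using cell_covers by metis
  then obtain t d where td: "\<And>i. i < N \<Longrightarrow> 0 < d i"
    "\<And>i y. i < N \<Longrightarrow> y \<in> {1/8..1/4} \<Longrightarrow> pull (t i) y \<in> cell N i \<and> d i \<le> dpull (t i) y"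
    by metis
  define \<eta> where "\<eta> = Min (d ` {..<N}) / 16"
  show ?thesis
  proof (rule that[of \<eta>])
    have "d ` {..<N} \<noteq> {}" using N(1) by auto
    then show "0 < \<eta>" using td(1) by (auto simp: \<eta>_def)
    fix n
    obtain i m where i: "i < N" and m: "\<And>w y. length w = n \<Longrightarrow> y \<in> cell N i \<Longrightarrow> m w \<le> den w y"
      "1/16 \<le> (\<Sum>w | length w = n. m w)"
      using N(2) by metis
    define P where "P = {w. length w = n \<and> 0 < m w}"
    have finP: "finite P" by (rule finite_subset[OF _ finite_words[of n]]) (auto simp: P_def)
    have P: "t i @ w \<in> full (length (t i) + n) \<and> d i * m w \<le> mind (t i @ w)" if w: "w \<in> P" for w
    proof -
      have w': "length w = n" "0 < m w" using w by (auto simp: P_def)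
      \<comment> \<open>\<open>den w\<close> vanishes where the branch misses A, so a positive lower
        bound makes the branch full over the cell.\<close>
      have *: "pull w z \<in> {1/8..1/4} \<and> m w \<le> dpull w z" if "z \<in> cell N i" for z
        using m(1)[OF w'(1) that] w'(2) by (auto simp: den_def split: if_splits)
      have "pull (t i @ w) y \<in> {1/8..1/4} \<and> d i * m w \<le> dpull (t i @ w) y" if "y \<in> {1/8..1/4}" for y
        using td(2)[OF i that] *[of "pull (t i) y"] td(1)[OF i] w'(2)
        by (auto simp: pull_append dpull_append mult.commute[of "d i"] intro!: mult_mono)
      moreover have "0 < d i * m w" using td(1)[OF i] w'(2) by simp
      ultimately show ?thesis using w'(1) by (fastforce simp: full_def intro: mind_ge)
    qed
    have "\<eta> \<le> d i * (1/16)" using i by (auto simp: \<eta>_def)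
    also have "\<dots> \<le> d i * (\<Sum>w | length w = n. m w)" using m(2) td(1)[OF i] by (intro mult_left_mono) auto
    also have "\<dots> \<le> d i * (\<Sum>w\<in>P. m w)"
    proof (rule mult_left_mono)
      have "(\<Sum>w | length w = n. m w) = (\<Sum>w\<in>{w. length w = n} - P. m w) + (\<Sum>w\<in>P. m w)"
        by (rule sum.subset_diff) (use finite_words in \<open>auto simp: P_def\<close>)
      moreover have "(\<Sum>w\<in>{w. length w = n} - P. m w) \<le> 0"
        by (rule sum_nonpos) (auto simp: P_def)
      ultimately show "(\<Sum>w | length w = n. m w) \<le> (\<Sum>w\<in>P. m w)" by simp
    qed (use td(1)[OF i] in simp)
    also have "\<dots> \<le> (\<Sum>w\<in>P. mind (t i @ w))"
      unfolding sum_distrib_left by (intro sum_mono) (use P in auto)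
    also have "\<dots> = (\<Sum>w\<in>(@) (t i) ` P. mind w)"
      by (simp add: sum.reindex inj_on_def)
    also have "\<dots> \<le> (\<Sum>w\<in>full (length (t i) + n). mind w)"
      using P by (intro sum_mono2 finite_full) (auto intro: less_imp_le mind_pos)
    finally show "\<exists>m\<ge>n. \<eta> \<le> (\<Sum>w\<in>full m. mind w)" by (intro exI[of _ "length (t i) + n"]) auto
  qed
qed

lemma full_mass_powr:
  assumes "s < 1"
  obtains n where "1 \<le> n" "1 \<le> (\<Sum>w\<in>full n. mind w powr s)"
proof -
  obtain \<eta> where \<eta>: "0 < \<eta>" "\<And>n. \<exists>m\<ge>n. \<eta> \<le> (\<Sum>w\<in>full m. mind w)" using full_mass by blast
  have "1 < \<sigma> powr (1 - s)" using \<sigma> assms by (intro gr_one_powr) auto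
  then obtain n where n: "1 / \<eta> < (\<sigma> powr (1 - s)) ^ n" using real_arch_pow by blast
  obtain m where m: "Suc n \<le> m" "\<eta> \<le> (\<Sum>w\<in>full m. mind w)" using \<eta>(2) by blast
  have "(\<sigma> powr (1 - s)) ^ n \<le> (\<sigma> powr (1 - s)) ^ m"
    using m(1) \<open>1 < \<sigma> powr (1 - s)\<close> by (intro power_increasing) auto
  then have "1 / \<eta> < (\<sigma> powr (1 - s)) ^ m" using n by simp
  then have "1 \<le> \<eta> * (\<sigma> powr (1 - s)) ^ m" using \<eta>(1) by (simp add: field_simps)
  also have "\<dots> \<le> (\<Sum>w\<in>full m. mind w) * (\<sigma> powr (1 - s)) ^ m" using m(2) by (intro mult_right_mono) auto
  also have "\<dots> \<le> (\<Sum>w\<in>full m. mind w powr s)"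
    unfolding sum_distrib_right
  proof (rule sum_mono)
    fix w assume w: "w \<in> full m"
    have pos: "0 < mind w" using mind_pos w by blast
    have "mind w \<le> (1 / \<sigma>) ^ m" using mind_le_power[of w] w by (simp add: full_def)
    then have "((1 / \<sigma>) ^ m) powr (s - 1) \<le> mind w powr (s - 1)"
      using pos assms by (intro powr_mono2') auto
    moreover have "((1 / \<sigma>) ^ m) powr (s - 1) = (\<sigma> powr (1 - s)) ^ m"
    proof -
      have "(1 / \<sigma>) ^ m = \<sigma> powr (- real m)"
        using \<sigma>(2) by (simp add: powr_minus powr_realpow power_one_over inverse_eq_divide)
      then have "((1 / \<sigma>) ^ m) powr (s - 1) = \<sigma> powr ((1 - s) * real m)"
        by (simp add: powr_powr algebra_simps)
      then show ?thesis using \<sigma>(2) by (simp add: powr_power mult.commute)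
    qed
    ultimately have "mind w * (\<sigma> powr (1 - s)) ^ m \<le> mind w * mind w powr (s - 1)"
      using pos by (intro mult_left_mono) auto
    also have "\<dots> = mind w powr s" using pos by (simp add: powr_diff)
    finally show "mind w * (\<sigma> powr (1 - s)) ^ m \<le> mind w powr s" .
  qed
  finally show ?thesis using that[of m] m(1) by simp
qed

end

subsection \<open>Smoothness of the iterates\<close>

text \<open>Two points of U at distance below e/2 lie in a common ball around a point of K, where
  the mean value theorem gives the constant B. U need not be convex; for points farther apart the
  increment is at most 2P, hence at most 4P/e times the distance.\<close>

lemma lipschitz_near_compact:
  fixes D E :: "real \<Rightarrow> real"
  assumes K: "compact K" "K \<subseteq> V" "open V"
    and D: "\<And>x. x \<in> V \<Longrightarrow> (D has_real_derivative E x) (at x)" and E: "continuous_on V E"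
  obtains U C where "open U" "K \<subseteq> U" "U \<subseteq> V" "\<And>x y. x \<in> U \<Longrightarrow> y \<in> U \<Longrightarrow> \<bar>D x - D y\<bar> \<le> C * \<bar>x - y\<bar>"
proof -
  obtain e where e: "0 < e" "(\<Union>x\<in>K. cball x e) \<subseteq> V"
    using compact_subset_open_imp_cball_epsilon_subset[OF K(1,3,2)] by blast
  define K' where "K' = (\<Union>x\<in>K. cball x e)"
  have K': "compact K'" unfolding K'_def by (rule compact_minkowski_sum_cball[OF K(1)])
  have "continuous_on K' E" using E e(2) continuous_on_subset unfolding K'_def by blast
  then have "bounded (E ` K')" using K' compact_continuous_image compact_imp_bounded by blast
  then obtain B where B: "0 < B" "\<And>x. x \<in> K' \<Longrightarrow> \<bar>E x\<bar> \<le> B" unfolding bounded_pos by auto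
  have "continuous_on V D" by (rule DERIV_continuous_on) (use D has_field_derivative_at_within in blast)
  then have "continuous_on K' D" using e(2) continuous_on_subset unfolding K'_def by blast
  then have "bounded (D ` K')" using K' compact_continuous_image compact_imp_bounded by blast
  then obtain P where P: "0 < P" "\<And>x. x \<in> K' \<Longrightarrow> \<bar>D x\<bar> \<le> P" unfolding bounded_pos by auto
  define U where "U = (\<Union>x\<in>K. ball x (e / 2))"
  define C where "C = B + 4 * P / e"
  show ?thesis
  proof (rule that[of U C])
    show "open U" by (auto simp: U_def)
    show "K \<subseteq> U" using e(1) by (force simp: U_def)
    have "U \<subseteq> K'" using e(1) by (force simp: U_def K'_def)
    then show "U \<subseteq> V" using e(2) by (auto simp: K'_def)
    fix x y assume xy: "x \<in> U" "y \<in> U"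
    show "\<bar>D x - D y\<bar> \<le> C * \<bar>x - y\<bar>"
    proof (cases "\<bar>x - y\<bar> < e / 2")
      case True
      obtain k where k: "k \<in> K" "dist k x < e / 2" using xy by (auto simp: U_def)
      have "dist k y \<le> dist k x + dist x y" by (rule dist_triangle)
      then have ball: "x \<in> cball k e" "y \<in> cball k e"
        using k True e(1) by (auto simp: dist_real_def[of x y])
      have sub: "cball k e \<subseteq> K'" using k by (auto simp: K'_def)
      have "norm (D x - D y) \<le> B * norm (x - y)"
      proof (rule field_differentiable_bound[of "cball k e" D E])
        show "(D has_field_derivative E z) (at z within cball k e)" if "z \<in> cball k e" for z
          using D[of z] that sub e(2) has_field_derivative_at_within unfolding K'_def by blast
      qed (use B sub ball in auto)
      also have "\<dots> \<le> C * norm (x - y)"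
        using P e by (intro mult_right_mono) (auto simp: C_def)
      finally show ?thesis by simp
    next
      case False
      have "\<bar>D x\<bar> \<le> P" "\<bar>D y\<bar> \<le> P" using P(2) xy \<open>U \<subseteq> K'\<close> by blast+
      then have "\<bar>D x - D y\<bar> \<le> P + P" by linarith
      also have "\<dots> \<le> 4 * P / e * (e / 2)" using e by simp
      also have "\<dots> \<le> C * \<bar>x - y\<bar>"
        unfolding C_def using False P B e by (intro mult_mono) auto
      finally show ?thesis .
    qed
  qed
qed

context odd_lorenz
begin

definition "df x = \<alpha> * \<theta> * \<bar>x\<bar> powr (\<alpha> - 1)"

definition "ddf x = \<alpha> * \<theta> * (\<alpha> - 1) * \<bar>x\<bar> powr (\<alpha> - 3) * x"

lemma side_cases:
  assumes "x \<noteq> 0"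
  obtains b where "0 < sg b * x" "\<bar>x\<bar> = sg b * x"
  using that[of True] that[of False] assms by (cases "x < 0") auto

lemma open_side: "open {y. 0 < sg b * y}" "open {y. 0 < sg b * y \<and> sg b * y < 1/2}"
proof -
  show 1: "open {y. 0 < sg b * y}" by (intro open_Collect_less continuous_intros)
  have "open {y. sg b * y < 1/2}" by (intro open_Collect_less continuous_intros)
  then have "open ({y. 0 < sg b * y} \<inter> {y. sg b * y < 1/2})" using 1 by (rule open_Int[rotated])
  then show "open {y. 0 < sg b * y \<and> sg b * y < 1/2}" by (simp add: Collect_conj_eq)
qed

lemma f_props:
  assumes "x \<noteq> 0" "\<bar>x\<bar> < 1/2"
  shows "(f has_real_derivative df x) (at x)" "(df has_real_derivative ddf x) (at x)"
    "\<bar>f x\<bar> < 1/2" "\<sigma> \<le> df x"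
proof -
  obtain b where b: "0 < sg b * x" "\<bar>x\<bar> = sg b * x" using side_cases[OF assms(1)] by blast
  have "((\<lambda>y. sg b * F (sg b * y)) has_real_derivative sg b * (\<theta> * (\<alpha> * (sg b * x) powr (\<alpha> - 1) * sg b))) (at x)"
    unfolding F_def using b by (auto intro!: derivative_eq_intros)
  moreover have "sg b * (\<theta> * (\<alpha> * (sg b * x) powr (\<alpha> - 1) * sg b)) = df x"
    unfolding df_def b(2) by (simp add: sg_def)
  ultimately have "((\<lambda>y. sg b * F (sg b * y)) has_real_derivative df x) (at x)" by simp
  then show "(f has_real_derivative df x) (at x)"
    by (rule has_field_derivative_transform_within_open[OF _ open_side(2)[of b]])
      (use assms b f_eq[of b] in auto)
  have "((\<lambda>y. \<alpha> * \<theta> * (sg b * y) powr (\<alpha> - 1)) has_real_derivative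
      \<alpha> * \<theta> * ((\<alpha> - 1) * (sg b * x) powr (\<alpha> - 1 - 1) * sg b)) (at x)"
    using b by (auto intro!: derivative_eq_intros)
  moreover have "\<alpha> * \<theta> * ((\<alpha> - 1) * (sg b * x) powr (\<alpha> - 1 - 1) * sg b) = ddf x"
  proof -
    have "(sg b * x) powr (\<alpha> - 1 - 1) = (sg b * x) powr (\<alpha> - 3) * (sg b * x)"
      using b(1) powr_mult_base[of "sg b * x" "\<alpha> - 3"] by (simp add: mult.commute)
    then show ?thesis unfolding ddf_def b(2) by (simp add: sg_def)
  qed
  ultimately have "((\<lambda>y. \<alpha> * \<theta> * (sg b * y) powr (\<alpha> - 1)) has_real_derivative ddf x) (at x)" by simp
  then show "(df has_real_derivative ddf x) (at x)"
    by (rule has_field_derivative_transform_within_open[OF _ open_side(1)[of b]])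
      (use b in \<open>auto simp: df_def sg_def\<close>)
  have "F 0 < F (sg b * x)" by (rule F_strict_mono) (use b in auto)
  moreover have "F (sg b * x) < F (1/2)" by (rule F_strict_mono) (use b assms in auto)
  ultimately have "\<bar>F (sg b * x)\<bar> < 1/2" using F_half by auto
  moreover have "f x = sg b * F (sg b * x)" using b assms by (intro f_eq) auto
  ultimately show "\<bar>f x\<bar> < 1/2" by simp
  have "(1/2) powr (\<alpha> - 1) \<le> \<bar>x\<bar> powr (\<alpha> - 1)" using assms \<alpha> by (intro powr_mono2') auto
  then show "\<sigma> \<le> df x" using \<alpha> \<theta>_pos by (simp add: \<sigma>_def df_def)
qed

lemma continuous_df: "0 \<notin> S \<Longrightarrow> continuous_on S df" "0 \<notin> S \<Longrightarrow> continuous_on S ddf"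
  unfolding df_def ddf_def by (intro continuous_intros; auto)+

definition regular :: "nat \<Rightarrow> real set" where
  "regular n = {x. \<bar>x\<bar> < 1/2 \<and> (\<forall>s<n. (f ^^ s) x \<noteq> 0)}"

text \<open>The second derivative E is carried along because its continuity makes D Lipschitz near
  compact sets, which gives Hoelder exponent 1.\<close>

lemma iterate_smooth:
  "open (regular n) \<and> (\<forall>x\<in>regular n. \<bar>(f ^^ n) x\<bar> < 1/2) \<and>
   (\<exists>D E. (\<forall>x\<in>regular n. ((f ^^ n) has_real_derivative D x) (at x) \<and> (D has_real_derivative E x) (at x) \<and> \<sigma> ^ n \<le> D x)
     \<and> continuous_on (regular n) E)"
proof (induction n)
  case 0
  have "regular 0 = {-1/2<..<1/2}" by (auto simp: regular_def)
  then show ?case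
    by (intro conjI exI[of _ "\<lambda>_. 1"] exI[of _ "\<lambda>_. 0"]) (auto simp: id_def abs_less_iff)
next
  case (Suc n)
  then obtain D E where IH: "open (regular n)" "\<And>x. x \<in> regular n \<Longrightarrow> \<bar>(f ^^ n) x\<bar> < 1/2"
    "\<And>x. x \<in> regular n \<Longrightarrow> ((f ^^ n) has_real_derivative D x) (at x)"
    "\<And>x. x \<in> regular n \<Longrightarrow> (D has_real_derivative E x) (at x)"
    "\<And>x. x \<in> regular n \<Longrightarrow> \<sigma> ^ n \<le> D x" "continuous_on (regular n) E"
    by blast
  have eq: "regular (Suc n) = regular n \<inter> (f ^^ n) -` (- {0})"
    by (auto simp: regular_def less_Suc_eq)
  have cont: "continuous_on (regular n) (f ^^ n)"
    by (rule DERIV_continuous_on) (use IH(3) has_field_derivative_at_within in blast)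
  have contD: "continuous_on (regular n) D"
    by (rule DERIV_continuous_on) (use IH(4) has_field_derivative_at_within in blast)
  have op: "open (regular (Suc n))"
    unfolding eq using IH(1) cont by (intro continuous_open_preimage) auto
  define D' where "D' x = df ((f ^^ n) x) * D x" for x
  define E' where "E' x = df ((f ^^ n) x) * E x + ddf ((f ^^ n) x) * D x * D x" for x
  have props: "((f ^^ Suc n) has_real_derivative D' x) (at x) \<and> (D' has_real_derivative E' x) (at x) \<and> \<sigma> ^ Suc n \<le> D' x
      \<and> \<bar>(f ^^ Suc n) x\<bar> < 1/2" if x: "x \<in> regular (Suc n)" for x
  proof -
    have x': "x \<in> regular n" "(f ^^ n) x \<noteq> 0" using x eq by auto
    note fp = f_props[OF x'(2) IH(2)[OF x'(1)]]
    have "((\<lambda>y. f ((f ^^ n) y)) has_real_derivative D' x) (at x)"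
      unfolding D'_def by (rule DERIV_chain2[OF fp(1) IH(3)[OF x'(1)]])
    moreover have "(f ^^ Suc n) = (\<lambda>y. f ((f ^^ n) y))" by auto
    moreover have "(D' has_real_derivative E' x) (at x)"
    proof -
      have "((\<lambda>y. df ((f ^^ n) y)) has_real_derivative ddf ((f ^^ n) x) * D x) (at x)"
        by (rule DERIV_chain2[OF fp(2) IH(3)[OF x'(1)]])
      from DERIV_mult'[OF this IH(4)[OF x'(1)]] show ?thesis
        unfolding D'_def[abs_def] E'_def by simp
    qed
    moreover have "\<sigma> * \<sigma> ^ n \<le> df ((f ^^ n) x) * D x"
      using fp(4) IH(5)[OF x'(1)] \<sigma>(2) by (intro mult_mono) auto
    ultimately show ?thesis using fp(3) by (simp add: D'_def)
  qed
  have contE: "continuous_on (regular (Suc n)) E'"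
  proof -
    have sub: "regular (Suc n) \<subseteq> regular n" by (auto simp: eq)
    have im: "(f ^^ n) ` regular (Suc n) \<subseteq> - {0}" by (auto simp: eq)
    have 1: "continuous_on (regular (Suc n)) (\<lambda>x. df ((f ^^ n) x))"
      by (rule continuous_on_compose2[OF continuous_df(1)[of "- {0}"] continuous_on_subset[OF cont sub] im]) simp
    have 2: "continuous_on (regular (Suc n)) (\<lambda>x. ddf ((f ^^ n) x))"
      by (rule continuous_on_compose2[OF continuous_df(2)[of "- {0}"] continuous_on_subset[OF cont sub] im]) simp
    show ?thesis unfolding E'_def
      by (intro continuous_intros 1 2 continuous_on_subset[OF contD sub] continuous_on_subset[OF IH(6) sub])
  qed
  show ?case using op props contE by blast
qed

lemma iterate_C1:
  assumes "1 \<le> n" "compact K" "K \<subseteq> regular n"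
  obtains U where "open U" "K \<subseteq> U" "C1_Hoelder_on 1 U (f ^^ n)" "expanding_on U (f ^^ n)"
proof -
  obtain D E where op: "open (regular n)" and DE: "\<And>x. x \<in> regular n \<Longrightarrow> ((f ^^ n) has_real_derivative D x) (at x)"
    "\<And>x. x \<in> regular n \<Longrightarrow> (D has_real_derivative E x) (at x)"
    "\<And>x. x \<in> regular n \<Longrightarrow> \<sigma> ^ n \<le> D x" "continuous_on (regular n) E"
    using iterate_smooth[of n] by blast
  obtain U C where U: "open U" "K \<subseteq> U" "U \<subseteq> regular n"
    "\<And>x y. x \<in> U \<Longrightarrow> y \<in> U \<Longrightarrow> \<bar>D x - D y\<bar> \<le> C * \<bar>x - y\<bar>"
    using lipschitz_near_compact[OF assms(2,3) op DE(2,4)] by metis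
  have deriv: "deriv (f ^^ n) x = D x" if "x \<in> U" for x
    using DERIV_imp_deriv DE(1) U(3) that by blast
  have "C1_Hoelder_on 1 U (f ^^ n)"
    unfolding C1_Hoelder_on_def
  proof (intro conjI ballI exI)
    fix x assume "x \<in> U"
    then show "(f ^^ n) differentiable at x" using DE(1) U(3) real_differentiable_def by blast
  next
    fix x y assume "x \<in> U" "y \<in> U"
    then show "\<bar>deriv (f ^^ n) x - deriv (f ^^ n) y\<bar> \<le> C * \<bar>x - y\<bar> powr 1" using U(4) deriv by simp
  qed
  moreover have "expanding_on U (f ^^ n)"
    unfolding expanding_on_def
  proof (intro exI[of _ "\<sigma> ^ n"] conjI ballI)
    show "1 < \<sigma> ^ n" using \<sigma>(2) assms(1) by (intro one_less_power) auto
    fix x assume x: "x \<in> U"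
    then have "\<sigma> ^ n \<le> D x" using DE(3) U(3) by blast
    then show "\<sigma> ^ n \<le> \<bar>deriv (f ^^ n) x\<bar>" using deriv[OF x] by simp
  qed
  ultimately show ?thesis using that U by blast
qed

subsection \<open>The Cantor sets\<close>

definition level :: "nat \<Rightarrow> real set" where
  "level n = (\<Union>w\<in>full n. pull w ` {1/8..1/4})"

text \<open>The limit set of the full words of length n, described without enumerating them, so that
  different n can be compared.\<close>

definition cantor :: "nat \<Rightarrow> real set" where
  "cantor n = {x. \<forall>k. ((f ^^ n) ^^ k) x \<in> level n}"

lemma full_pull:
  assumes "w \<in> full n" "y \<in> {1/8..1/4}"
  shows "pull w y \<in> {1/8..1/4}" "(f ^^ n) (pull w y) = y" "pull w y \<in> regular n"
proof -
  have w: "pull w y \<in> {1/8..1/4}" "0 < dpull w y" "length w = n" using assms by (auto simp: full_def)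
  then show "pull w y \<in> {1/8..1/4}" "(f ^^ n) (pull w y) = y" "pull w y \<in> regular n"
    using orbit_pull[of w y] by (auto simp: regular_def)
qed

text \<open>For a full word the clamp is inactive on A, so \<open>prim\<close> and
  \<open>den\<close> agree there with \<open>pull\<close> and \<open>dpull\<close> and the integral
  estimates apply.\<close>

lemma full_pull_diff:
  assumes "w \<in> full n" "x \<in> {1/8..1/4}" "y \<in> {1/8..1/4}" "x \<le> y"
  shows "mind w * (y - x) \<le> pull w y - pull w x" "pull w y - pull w x \<le> (1 / \<sigma>) ^ n * (y - x)"
proof -
  have eq: "prim w z = pull w z" "den w z = dpull w z" if "z \<in> {1/8..1/4}" for z
    using full_pull(1)[OF assms(1) that] by (auto simp: prim_def den_def)
  have "length w = n" using assms by (simp add: full_def)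
  then have "mind w \<le> den w z" "den w z \<le> (1 / \<sigma>) ^ n" if "x \<le> z" "z \<le> y" for z
    using eq(2)[of z] that assms mind_le[of z w] dpull_le[of w z] by auto
  then show "mind w * (y - x) \<le> pull w y - pull w x" "pull w y - pull w x \<le> (1 / \<sigma>) ^ n * (y - x)"
    using prim_diff_ge[of x y "mind w" w] prim_diff_le[of x y w "(1 / \<sigma>) ^ n"] assms eq(1) by auto
qed

lemma cantor_level: "x \<in> cantor n \<Longrightarrow> x \<in> level n"
  unfolding cantor_def mem_Collect_eq by (metis funpow_0)

lemma iterate_cantor: "x \<in> cantor n \<Longrightarrow> (f ^^ n) x \<in> cantor n"
  unfolding cantor_def mem_Collect_eq by (metis funpow_Suc_right comp_apply)

text \<open>The full words met along m blocks of n steps are concatenated; the block met first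
  stands last.\<close>

lemma cantor_word:
  assumes "x \<in> cantor n"
  shows "\<exists>w\<in>full (n * m). \<exists>y\<in>{1/8..1/4}. x = pull w y"
  using assms
proof (induction m arbitrary: x)
  case 0
  have "x \<in> {1/8..1/4}" using cantor_level[OF 0] full_pull(1) by (fastforce simp: level_def)
  then show ?case by (intro bexI[of _ "[]"] bexI[of _ x]) (auto simp: full_def)
next
  case (Suc m)
  obtain u z where u: "u \<in> full n" "z \<in> {1/8..1/4}" "x = pull u z"
    using cantor_level[OF Suc.prems] by (auto simp: level_def)
  have "(f ^^ n) x = z" using full_pull(2)[OF u(1,2)] u(3) by simp
  then have "z \<in> cantor n" using iterate_cantor[OF Suc.prems] by simp
  then obtain w y where w: "w \<in> full (n * m)" "y \<in> {1/8..1/4}" "z = pull w y" using Suc.IH by blast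
  have "w @ u \<in> full (n * Suc m)" using full_append[OF w(1) u(1)] by (simp add: add.commute)
  moreover have "x = pull (w @ u) y" using u w by (simp add: pull_append)
  ultimately show ?case using w(2) by blast
qed

lemma cantor_mono: "cantor n \<subseteq> cantor (n * m)"
proof
  fix x assume x: "x \<in> cantor n"
  have it: "((f ^^ n) ^^ j) x \<in> cantor n" for j
    by (induction j) (use x iterate_cantor in auto)
  have "((f ^^ (n * m)) ^^ k) x \<in> level (n * m)" for k
  proof -
    have "((f ^^ (n * m)) ^^ k) x = ((f ^^ n) ^^ (m * k)) x" by (simp add: funpow_mult mult.assoc mult.commute mult.left_commute)
    then show ?thesis using cantor_word[OF it[of "m * k"], of m] by (auto simp: level_def)
  qed
  then show "x \<in> cantor (n * m)" by (simp add: cantor_def)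
qed

lemma full_ifs:
  assumes n: "1 \<le> n"
  obtains r h where "bij_betw h {..<r} (full n)" "separated_ifs (1/8) (1/4) ((1 / \<sigma>) ^ n) r (\<lambda>j. pull (h j)) (f ^^ n)"
proof -
  obtain h where h: "bij_betw h {..<card (full n)} (full n)"
    using ex_bij_betw_nat_finite[OF finite_full] by (auto simp: atLeast0LessThan)
  then have hf: "h j \<in> full n" if "j < card (full n)" for j
    using that by (auto simp: bij_betw_def)
  have "separated_ifs (1/8) (1/4) ((1 / \<sigma>) ^ n) (card (full n)) (\<lambda>j. pull (h j)) (f ^^ n)"
  proof
    show "(1 / \<sigma>) ^ n < 1" using \<sigma>(2) n by (intro power_less_one_iff[THEN iffD2]) auto
    fix j x assume j: "j < card (full n)" and x: "x \<in> {1/8..1/4::real}"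
    show "pull (h j) x \<in> {1/8..1/4}" "(f ^^ n) (pull (h j) x) = x" using full_pull[OF hf[OF j] x] by auto
    fix y assume y: "y \<in> {1/8..1/4::real}" and "x < y"
    then show "pull (h j) x < pull (h j) y" "pull (h j) y - pull (h j) x \<le> (1 / \<sigma>) ^ n * (y - x)"
      using full_pull_diff[OF hf[OF j] x y] mult_pos_pos[OF mind_pos[OF hf[OF j]], of "y - x"] by auto
  next
    fix i j x y assume ij: "i < card (full n)" "j < card (full n)" and x: "x \<in> {1/8..1/4::real}" and y: "y \<in> {1/8..1/4::real}"
      and eq: "pull (h i) x = pull (h j) y"
    have "\<bar>pull (h i) x\<bar> < 1/2" using full_pull(1)[OF hf[OF ij(1)] x] by auto
    then have "h i = h j"
      by (intro pull_itinerary[OF _ eq]) (use hf[OF ij(1)] hf[OF ij(2)] x y in \<open>auto simp: full_def\<close>)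
    then show "i = j" using h ij by (auto simp: bij_betw_def inj_on_def)
  qed (use \<sigma>(2) in auto)
  then show ?thesis using that h by blast
qed

lemma cantor_regular:
  assumes n: "1 \<le> n" and uv: "u \<in> cantor n" "v \<in> cantor n" "u \<noteq> v"
  shows "regular_cantor_set_for f (cantor n)"
proof -
  obtain r h where h: "bij_betw h {..<r} (full n)"
    and ifs: "separated_ifs (1/8) (1/4) ((1 / \<sigma>) ^ n) r (\<lambda>j. pull (h j)) (f ^^ n)"
    using full_ifs[OF n] by blast
  interpret separated_ifs "1/8" "1/4" "(1 / \<sigma>) ^ n" r "\<lambda>j. pull (h j)" "f ^^ n" by (rule ifs)
  have hf: "h ` {..<r} = full n" using h by (simp add: bij_betw_def)
  have im: "images = level n" unfolding images_def level_def hf[symmetric] by simp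
  have K: "limit_set = cantor n" unfolding limit_set_def cantor_def im ..
  have reg: "level n \<subseteq> regular n" using full_pull(3) by (auto simp: level_def)
  have "compact (level n)"
    unfolding level_def by (intro compact_UN finite_full compact_continuous_image continuous_pull compact_Icc)
  then obtain U where U: "open U" "level n \<subseteq> U" "C1_Hoelder_on 1 U (f ^^ n)" "expanding_on U (f ^^ n)"
    using iterate_C1[OF n _ reg] by metis
  obtain a b where ab: "regular_cantor_set (cantor n) r a b (f ^^ n)" "\<And>j. j < r \<Longrightarrow> {a j..b j} \<subseteq> pull (h j) ` {1/8..1/4}"
    using regular_cantor_limit_set[of u v U 1] uv U unfolding K im by auto
  have "0 \<notin> (f ^^ s) ` {a j..b j}" if "j < r" "s < n" for j s
  proof -
    have "h j \<in> full n" using hf that(1) by auto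
    then have "{a j..b j} \<subseteq> level n" using ab(2)[OF that(1)] unfolding level_def by blast
    then show ?thesis using reg that(2) by (force simp: regular_def)
  qed
  moreover have "cantor n \<subseteq> lorenz_interval - {0}"
    using limit_set_subset(2) unfolding K by (rule order_trans) auto
  ultimately show ?thesis unfolding regular_cantor_set_for_def using ab(1) n by blast
qed

lemma cantor_large:
  assumes "0 < s" "s < 1"
  obtains n u v where "1 \<le> n" "u \<in> cantor n" "v \<in> cantor n" "u \<noteq> v" "ereal s \<le> hausdorff_dim (cantor n)"
proof -
  obtain n where n: "1 \<le> n" "1 \<le> (\<Sum>w\<in>full n. mind w powr s)" using full_mass_powr[OF assms(2)] by blast
  obtain r h where h: "bij_betw h {..<r} (full n)"
    and ifs: "separated_ifs (1/8) (1/4) ((1 / \<sigma>) ^ n) r (\<lambda>j. pull (h j)) (f ^^ n)"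
    using full_ifs[OF n(1)] by blast
  interpret separated_ifs "1/8" "1/4" "(1 / \<sigma>) ^ n" r "\<lambda>j. pull (h j)" "f ^^ n" by (rule ifs)
  have hf: "h ` {..<r} = full n" using h by (simp add: bij_betw_def)
  have hj: "h j \<in> full n" if "j < r" for j using hf that by auto
  have K: "limit_set = cantor n" unfolding limit_set_def cantor_def images_def level_def hf[symmetric] by simp
  have sum: "1 \<le> (\<Sum>j<r. mind (h j) powr s)" using n(2) sum.reindex_bij_betw[OF h, of "\<lambda>w. mind w powr s"] by simp
  \<comment> \<open>A single branch contracts, so alone it would contribute less than 1 to the
    sum.\<close>
  have "2 \<le> r"
  proof (rule ccontr)
    assume "\<not> 2 \<le> r"
    then consider "r = 0" | "r = 1" by linarith
    then show False
    proof cases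
      case 2
      have "mind (h 0) \<le> (1 / \<sigma>) ^ n" using mind_le_power[of "h 0"] hj[of 0] 2 by (simp add: full_def)
      then have "mind (h 0) < 1" using \<rho>(2) by simp
      then have "mind (h 0) powr s < 1" using mind_pos[OF hj[of 0]] 2 assms powr_less_mono2[of s "mind (h 0)" 1] by auto
      then show False using sum 2 by simp
    qed (use sum in simp)
  qed
  then have r: "0 < r" "1 < r" by auto
  obtain u where u: "u \<in> limit_set" "u \<in> pull (h 0) ` {1/8..1/4}"
    using branch_meets_limit_set[OF r(1)] by blast
  obtain v where v: "v \<in> limit_set" "v \<in> pull (h 1) ` {1/8..1/4}"
    using branch_meets_limit_set[OF r(2)] by blast
  obtain x where x: "x \<in> {1/8..1/4}" "u = pull (h 0) x" using u(2) by blast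
  obtain y where y: "y \<in> {1/8..1/4}" "v = pull (h 1) y" using v(2) by blast
  have "u \<noteq> v" using disj[OF r x(1) y(1)] x(2) y(2) by auto
  moreover have "ereal s \<le> hausdorff_dim limit_set"
  proof (rule hausdorff_dim_limit_set_ge[of "\<lambda>j. mind (h j)"])
    show "mind (h j) * (y - x) \<le> pull (h j) y - pull (h j) x"
      if "j < r" "x \<in> {1/8..1/4}" "y \<in> {1/8..1/4}" "x < y" for j x y
      using full_pull_diff(1)[OF hj[OF that(1)] that(2,3)] that(4) by simp
  qed (use \<open>2 \<le> r\<close> mind_pos hj sum in auto)
  ultimately show ?thesis using that n(1) u(1) v(1) unfolding K by blast
qed

lemma bounded_cantor: "bounded (cantor n)"
proof (rule bounded_subset[of "{1/8..1/4}"])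
  show "cantor n \<subseteq> {1/8..1/4}" using cantor_level full_pull(1) by (fastforce simp: level_def)
qed simp

lemma increasing_cantor_sets:
  "\<exists>C :: nat \<Rightarrow> real set. incseq C \<and> (\<forall>k. regular_cantor_set_for f (C k)) \<and> (\<lambda>k. hausdorff_dim (C k)) \<longlonglongrightarrow> 1"
proof -
  define s where "s k = 1 - 1 / real (k + 2)" for k
  have s: "0 < s k" "s k < 1" for k by (simp_all add: s_def field_simps)
  have "\<exists>n. 1 \<le> n \<and> (\<exists>u v. u \<in> cantor n \<and> v \<in> cantor n \<and> u \<noteq> v) \<and> ereal (s k) \<le> hausdorff_dim (cantor n)" for k
    using cantor_large[OF s[of k]] by metis
  then obtain n where n: "\<And>k. 1 \<le> n k" "\<And>k. \<exists>u v. u \<in> cantor (n k) \<and> v \<in> cantor (n k) \<and> u \<noteq> v"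
    "\<And>k. ereal (s k) \<le> hausdorff_dim (cantor (n k))"
    by metis
  \<comment> \<open>Partial products form a chain under divisibility, and \<open>n k\<close> divides
    \<open>N k\<close>, so the dimension bound for \<open>n k\<close> is inherited.\<close>
  define N where "N k = (\<Prod>i\<le>k. n i)" for k
  have sub: "cantor (n k) \<subseteq> cantor (N k)" for k
  proof -
    have "N k = n k * (\<Prod>i\<in>{..k} - {k}. n i)" unfolding N_def by (rule prod.remove) auto
    then show ?thesis using cantor_mono by metis
  qed
  have N1: "1 \<le> N k" for k
    unfolding N_def using n(1) by (simp add: Suc_le_eq prod_pos)
  have "incseq (\<lambda>k. cantor (N k))"
  proof (rule incseq_SucI)
    fix k
    have "N (Suc k) = N k * n (Suc k)" by (simp add: N_def mult.commute)
    then show "cantor (N k) \<subseteq> cantor (N (Suc k))" using cantor_mono by metis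
  qed
  moreover have "regular_cantor_set_for f (cantor (N k))" for k
    using cantor_regular[OF N1] n(2)[of k] sub[of k] by blast
  moreover have "(\<lambda>k. hausdorff_dim (cantor (N k))) \<longlonglongrightarrow> 1"
  proof (rule tendsto_sandwich)
    have "s \<longlonglongrightarrow> 1 - 0" unfolding s_def
      by (intro tendsto_diff tendsto_const LIMSEQ_ignore_initial_segment[OF lim_1_over_n, of 2])
    then show "(\<lambda>k. ereal (s k)) \<longlonglongrightarrow> 1" by (simp add: one_ereal_def)
    show "\<forall>\<^sub>F k in sequentially. ereal (s k) \<le> hausdorff_dim (cantor (N k))"
      using n(3) hausdorff_dim_mono[OF sub] order_trans by (blast intro: always_eventually)
    show "\<forall>\<^sub>F k in sequentially. hausdorff_dim (cantor (N k)) \<le> 1"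
      using hausdorff_dim_le_1[OF bounded_cantor] by (simp add: always_eventually)
  qed simp
  ultimately show ?thesis by blast
qed

end

section \<open>Reduction of \<open>lorenz_map\<close> to the odd normal form\<close>

lemma lorenz_map_odd_lorenz:
  assumes "0 < \<alpha>" "\<alpha> < 1" "lorenz_map \<alpha> f"
  obtains \<theta> where "odd_lorenz \<alpha> \<theta> f"
proof -
  note L = assms(3)[unfolded lorenz_map_def]
  obtain \<theta> b0 b1 where "\<forall>x\<in>lorenz_interval. x > 0 \<longrightarrow> f x = \<theta> * (\<bar>x\<bar> powr \<alpha>) + b0"
    and "\<forall>x\<in>lorenz_interval. x < 0 \<longrightarrow> f x = - \<theta> * (\<bar>x\<bar> powr \<alpha>) + b1"
    using L[THEN conjunct1] by blast
  then have pos: "\<And>x. x \<in> lorenz_interval \<Longrightarrow> 0 < x \<Longrightarrow> f x = \<theta> * (\<bar>x\<bar> powr \<alpha>) + b0"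
    and neg: "\<And>x. x \<in> lorenz_interval \<Longrightarrow> x < 0 \<Longrightarrow> f x = - \<theta> * (\<bar>x\<bar> powr \<alpha>) + b1"
    by blast+
  have maps: "f ` (lorenz_interval - {0}) \<subseteq> lorenz_interval" using L[THEN conjunct2, THEN conjunct1] .
  have lim: "(f \<longlongrightarrow> 1/2) (at_left 0)" "(f \<longlongrightarrow> - 1/2) (at_right 0)" using L[THEN conjunct2, THEN conjunct2] by simp_all
  have ne: "f (1/2) \<noteq> 1/2" using L[THEN conjunct2, THEN conjunct2] by simp
  obtain f' where "\<forall>x\<in>lorenz_interval - {0}.
      (f has_real_derivative f' x) (at x within lorenz_interval - {0}) \<and> f' x > sqrt 2"
    using L[THEN conjunct2, THEN conjunct2, THEN conjunct2, THEN conjunct2, THEN conjunct1] by blast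
  then have der: "(f has_real_derivative f' x) (at x within lorenz_interval - {0}) \<and> f' x > sqrt 2"
    if "x \<in> lorenz_interval - {0}" for x
    using that by blast
  \<comment> \<open>The one-sided limits at 0 determine both constants; since the two branches share
    \<theta>, the map is odd.\<close>
  have l0: "((\<lambda>x. \<theta> * (\<bar>x\<bar> powr \<alpha>) + b0) \<longlongrightarrow> \<theta> * (\<bar>0\<bar> powr \<alpha>) + b0) (at_right 0)"
    using assms by (intro tendsto_intros tendsto_powr') auto
  have e0: "\<forall>\<^sub>F x in at_right 0. f x = \<theta> * (\<bar>x\<bar> powr \<alpha>) + b0"
    unfolding eventually_at_right_field by (intro exI[of _ "1/2"]) (simp add: pos)
  have "(f \<longlongrightarrow> b0) (at_right 0)" using tendsto_cong[THEN iffD2, OF e0 l0] assms by simp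
  then have b0: "b0 = -1/2" using tendsto_unique[OF _ _ lim(2)] by simp
  have l1: "((\<lambda>x. - \<theta> * (\<bar>x\<bar> powr \<alpha>) + b1) \<longlongrightarrow> - \<theta> * (\<bar>0\<bar> powr \<alpha>) + b1) (at_left 0)"
    using assms by (intro tendsto_intros tendsto_powr') auto
  have e1: "\<forall>\<^sub>F x in at_left 0. f x = - \<theta> * (\<bar>x\<bar> powr \<alpha>) + b1"
    unfolding eventually_at_left_field by (intro exI[of _ "-1/2"]) (simp add: neg)
  have "(f \<longlongrightarrow> b1) (at_left 0)" using tendsto_cong[THEN iffD2, OF e1 l1] assms by simp
  then have b1: "b1 = 1/2" using tendsto_unique[OF _ _ lim(1)] by simp
  have "f (1/2) \<in> lorenz_interval" by (rule subsetD[OF maps]) (intro imageI, simp)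
  then have range: "\<theta> * (1/2) powr \<alpha> < 1" using ne pos[of "1/2"] b0 by auto
  \<comment> \<open>At the endpoint 1/2 the derivative is one-sided; its uniqueness within {0<..1/2}
    identifies \<open>f' (1/2)\<close>.\<close>
  have "((\<lambda>x. \<theta> * x powr \<alpha> - 1/2) has_real_derivative \<alpha> * \<theta> * (1/2) powr (\<alpha> - 1)) (at (1/2) within {0<..1/2})"
    by (auto intro!: derivative_eq_intros)
  moreover have "((\<lambda>x. \<theta> * x powr \<alpha> - 1/2) has_real_derivative f' (1/2)) (at (1/2) within {0<..1/2})"
  proof (rule has_field_derivative_transform_within)
    show "0 < (1 :: real)" by simp
    have "(f has_real_derivative f' (1/2)) (at (1/2) within lorenz_interval - {0})"
      using der[of "1/2"] by simp
    then show "(f has_real_derivative f' (1/2)) (at (1/2) within {0<..1/2})"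
      by (rule DERIV_subset) auto
    show "f x = \<theta> * x powr \<alpha> - 1/2" if "x \<in> {0<..1/2}" for x
      using pos[of x] that b0 by simp
  qed simp
  moreover have "at (1/2 :: real) within {0<..1/2} \<noteq> bot"
    by (simp add: trivial_limit_within)
  ultimately have "\<alpha> * \<theta> * (1/2) powr (\<alpha> - 1) = f' (1/2)"
    by (rule has_field_derivative_unique)
  then have slope: "sqrt 2 < \<alpha> * \<theta> * (1/2) powr (\<alpha> - 1)" using der[of "1/2"] by simp
  have "odd_lorenz \<alpha> \<theta> f"
  proof
    show "f x = \<theta> * x powr \<alpha> - 1/2" if "0 < x" "x \<le> 1/2" for x
      using pos[of x] that b0 by simp
    show "f x = 1/2 - \<theta> * (- x) powr \<alpha>" if "-1/2 \<le> x" "x < 0" for x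
      using neg[of x] that b1 by simp
  qed (use assms slope range in auto)
  then show ?thesis using that by blast
qed

theorem theorem1:
  fixes f :: "real \<Rightarrow> real" and \<alpha> :: real
  assumes "0 < \<alpha>" and "\<alpha> < 1" and "lorenz_map \<alpha> f"
  shows "\<exists>C :: nat \<Rightarrow> real set.
           incseq C \<and>
           (\<forall>k. regular_cantor_set_for f (C k)) \<and>
           (\<lambda>k. hausdorff_dim (C k)) \<longlonglongrightarrow> 1"
proof -
  obtain \<theta> where "odd_lorenz \<alpha> \<theta> f" using lorenz_map_odd_lorenz[OF assms] by blast
  then show ?thesis by (rule odd_lorenz.increasing_cantor_sets)
qed

end
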